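(* Fix an integer $k\ge1$. For primes $p$ and $m\mid p-1$ such that $d=(p-1)/m$ is odd, we have \[ M_{2k}(p,m)=a(k)+O\Big(d\,p^{-1/(2\varphi(d))}(\log p)^{10k^2+10}\Big),\qquad p\to\infty, \] where the implied constant may depend on $k$.
   Context: $\mathcal{G}_m$ is the unique subgroup of $\mathbb{F}_p^*$ of index $m$; $\mathcal{X}_{p,m}$ is the group of multiplicative characters of $\mathbb{F}_p^*$ trivial on $\mathcal{G}_m$, $\mathcal{X}_{p,m}^-=\{\chi\in\mathcal{X}_{p,m}:\chi(-1)=-1\}$, $L(1,\chi)=\sum_{n\ge1}\chi(n)/n$, and $M_\nu(p,m)=\frac{2}{m}\sum_{\chi\in\mathcal{X}_{p,m}^-}|L(1,\chi)|^\nu$. $\tau_k(n)$ is the number of ordered $k$-tuples of positive integers with product $n$, and $a(k)=\sum_{n\ge1}\tau_k(n)^2/n^2$. $\varphi$ is Euler's totient function. *)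

theory Defs
  imports Complex_Main "HOL-Number_Theory.Residues"
begin

definition Fp_star :: "nat \<Rightarrow> int monoid" where
  "Fp_star p = mult_of (residue_ring (int p))"

definition complex_star :: "complex monoid" where
  "complex_star = \<lparr>carrier = UNIV - {0}, monoid.mult = (*), one = 1\<rparr>"

definition index_subgroup :: "nat \<Rightarrow> nat \<Rightarrow> int set" where
  "index_subgroup p m =
     (THE H. subgroup H (Fp_star p) \<and> card (rcosets\<^bsub>Fp_star p\<^esub> H) = m)"

(* Requiring extensionality makes each character a unique HOL function, so that this set is
   in bijection with the group of characters and sums over it count each character once. *)
definition mult_characters :: "nat \<Rightarrow> (int \<Rightarrow> complex) set" where
  "mult_characters p = hom (Fp_star p) complex_star \<inter> extensional (carrier (Fp_star p))"

definition characters_trivial_on :: "nat \<Rightarrow> nat \<Rightarrow> (int \<Rightarrow> complex) set" where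
  "characters_trivial_on p m =
     {\<chi> \<in> mult_characters p. \<forall>x \<in> index_subgroup p m. \<chi> x = 1}"

definition odd_characters :: "nat \<Rightarrow> nat \<Rightarrow> (int \<Rightarrow> complex) set" where
  "odd_characters p m =
     {\<chi> \<in> characters_trivial_on p m.
        \<chi> (\<ominus>\<^bsub>residue_ring (int p)\<^esub> \<one>\<^bsub>residue_ring (int p)\<^esub>) = -1}"

(* The Dirichlet character mod p attached to \<chi>, with value 0 at the multiples of p. *)
definition dirichlet_ext :: "nat \<Rightarrow> (int \<Rightarrow> complex) \<Rightarrow> nat \<Rightarrow> complex" where
  "dirichlet_ext p \<chi> n = (if p dvd n then 0 else \<chi> (int n mod int p))"

(* The series converges only conditionally, hence the ordered sum; it is indexed from n = 0,
   so the n-th term is the one at Suc n. *)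
definition L_one :: "nat \<Rightarrow> (int \<Rightarrow> complex) \<Rightarrow> complex" where
  "L_one p \<chi> = (\<Sum>n. dirichlet_ext p \<chi> (Suc n) / of_nat (Suc n))"

definition L_moment :: "nat \<Rightarrow> nat \<Rightarrow> nat \<Rightarrow> real" where
  "L_moment \<nu> p m = 2 / real m * (\<Sum>\<chi>\<in>odd_characters p m. cmod (L_one p \<chi>) ^ \<nu>)"

definition tau :: "nat \<Rightarrow> nat \<Rightarrow> nat" where
  "tau k n = card {xs :: nat list. length xs = k \<and> (\<forall>x\<in>set xs. 0 < x) \<and> prod_list xs = n}"

definition a_const :: "nat \<Rightarrow> real" where
  "a_const k = (\<Sum>n. (real (tau k (Suc n)))\<^sup>2 / (real (Suc n))\<^sup>2)"

end

(*
  For an odd character chi, grouping the series for L(1,chi) into blocks of length p gives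
  L(1,chi) = sum_{0<r<p} c(r) chi(r) with |c(r) - 1/r| <= 1/p.  Hence L(1,chi)^k is a finite sum
  of c_k(s) chi(s), where c_k is the k-fold multiplicative convolution of c modulo p, and the
  divisor bound gives c_k(s) = tau_k(s)/s + O(p^(-7/8) (log p)^k).  Averaging over the odd
  characters trivial on G_m leaves a kernel K(s,u), bounded by 1, equal to 1 on the diagonal and
  supported on s^(2d) = u^(2d) mod p.  The diagonal gives a(k).  Off the diagonal p divides
  s^d - (+-u)^d, hence one of the norms N(s -+ u zeta), zeta a root of unity of order dividing d, so
  s + u >= p^(1/phi(d)); each s has at most 2d partners u, and Cauchy-Schwarz together with
  sum_{s<p} tau_k(s)^2/s <= (1 + log p)^(k^2) bounds this part by d p^(-1/(2 phi(d))) (log p)^(k^2).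
*)
theory Submission
  imports
    Defs
    "HOL-Number_Theory.Residue_Primitive_Roots"
    "HOL-Computational_Algebra.Polynomial"
begin

section \<open>Cyclotomic norms\<close>

text \<open>The exponent 1/(2 phi(d)) reflects an asymmetric gap: for an off-diagonal pair only the
  larger of s and u is known to be at least p^(1/phi(d))/2, so one factor is truncated, the other is
  not, and only the square root of the gap is gained. Oddness of d enters twice: it makes m even, so
  that h = m/2 is available and odd characters exist, and it gives s^d and (-u)^d opposite signs, so
  that the corresponding norm cannot vanish. Characters are handled through their value w at a fixed
  primitive root g. The odd characters trivial on the subgroup correspond to the solutions of w^h =
  -1, and orthogonality becomes the vanishing of power sums of these w. The norms are values of
  homogenised cyclotomic polynomials, whose coefficients are shown to be integers by division of
  monic polynomials. Up to logarithms the remaining errors are O(d p^(-1/2)), and p^(-1/2) <=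
  p^(-1/(2 phi(d))) because phi(d) >= 1.\<close>

definition int_coeffs :: "complex poly \<Rightarrow> bool" where
  "int_coeffs P \<longleftrightarrow> (\<forall>i. coeff P i \<in> \<int>)"

lemma int_coeffs_mult:
  assumes "int_coeffs P" "int_coeffs Q"
  shows "int_coeffs (P * Q)"
  using assms by (auto simp: int_coeffs_def coeff_mult intro!: Ints_sum Ints_mult)

lemma int_coeffs_prod:
  assumes "\<And>i. i \<in> S \<Longrightarrow> int_coeffs (f i)"
  shows "int_coeffs (prod f S)"
  using assms
  by (induction S rule: infinite_finite_induct) (auto intro!: int_coeffs_mult, auto simp: int_coeffs_def)

lemma int_coeffs_poly:
  assumes "int_coeffs P" "x \<in> \<int>"
  shows "poly P x \<in> \<int>"
  unfolding poly_altdef using assms by (auto simp: int_coeffs_def intro!: Ints_sum Ints_mult Ints_power)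

text \<open>Take the largest j at which the coefficient of Q is not an integer. In the coefficient
  of P * Q at deg P + j, the leading 1 of P multiplies exactly this coefficient, and every other
  term is an integer or zero. Staying inside complex polynomials lets the same object be integral
  and split into linear factors.\<close>

lemma int_coeffs_monic_cancel:
  assumes P: "int_coeffs P" "lead_coeff P = 1" and PQ: "int_coeffs (P * Q)"
  shows "int_coeffs Q"
proof (rule ccontr)
  assume "\<not> int_coeffs Q"
  define S where "S = {j. coeff Q j \<notin> \<int>}"
  have "S \<noteq> {}" using \<open>\<not> int_coeffs Q\<close> by (auto simp: S_def int_coeffs_def)
  have "S \<subseteq> {..degree Q}"
    by (auto simp: S_def) (metis Ints_0 coeff_eq_0 not_le)
  then have "finite S" by (rule finite_subset) auto
  define j where "j = Max S"
  have j: "coeff Q j \<notin> \<int>" using Max_in[OF \<open>finite S\<close> \<open>S \<noteq> {}\<close>] by (simp add: j_def S_def)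
  have gt: "coeff Q i \<in> \<int>" if "i > j" for i
    using that Max_ge[OF \<open>finite S\<close>, of i] by (force simp: j_def S_def)
  define n where "n = degree P"
  have "coeff (P * Q) (n + j) = (\<Sum>i\<le>n + j. coeff P i * coeff Q (n + j - i))"
    by (simp add: coeff_mult)
  also have "\<dots> = coeff P n * coeff Q j + (\<Sum>i\<in>{..n + j} - {n}. coeff P i * coeff Q (n + j - i))"
    by (subst sum.remove[of _ n]) auto
  also have "coeff P n = 1" using P by (simp add: n_def)
  finally have "coeff Q j = coeff (P * Q) (n + j) - (\<Sum>i\<in>{..n + j} - {n}. coeff P i * coeff Q (n + j - i))"
    by simp
  also have "\<dots> \<in> \<int>"
  proof (intro Ints_diff Ints_sum)
    fix i assume "i \<in> {..n + j} - {n}"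
    then show "coeff P i * coeff Q (n + j - i) \<in> \<int>"
      using P(1) gt[of "n + j - i"] coeff_eq_0[of P i]
      by (cases "i < n") (auto simp: n_def int_coeffs_def intro!: Ints_mult)
  qed (use PQ in \<open>auto simp: int_coeffs_def\<close>)
  finally show False using j by simp
qed

text \<open>The complex numbers of multiplicative order exactly n. At n = 0 the set is all of the
  complex plane, hence the positivity hypotheses below.\<close>

definition prim_roots :: "nat \<Rightarrow> complex set" where
  "prim_roots n = {z. z ^ n = 1 \<and> (\<forall>k. 0 < k \<and> k < n \<longrightarrow> z ^ k \<noteq> 1)}"

lemma finite_prim_roots [simp]: "n > 0 \<Longrightarrow> finite (prim_roots n)"
  by (rule finite_subset[of _ "{z. z ^ n = 1}"]) (auto simp: prim_roots_def finite_nth_roots)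

text \<open>Sort the n-th roots of unity by order: if d is the least positive exponent killing z,
  then z^(n mod d) = 1 forces n mod d = 0.\<close>

lemma prim_roots_Union:
  assumes "n > 0"
  shows "{z::complex. z ^ n = 1} = (\<Union>d\<in>{d. d dvd n}. prim_roots d)"
proof (intro equalityI subsetI)
  fix z :: complex assume z: "z \<in> {z. z ^ n = 1}"
  define d where "d = (LEAST d. 0 < d \<and> z ^ d = 1)"
  have d: "0 < d \<and> z ^ d = 1"
    unfolding d_def by (rule LeastI[of _ n]) (use z assms in auto)
  have min: "z ^ k \<noteq> 1" if "0 < k" "k < d" for k
    using not_less_Least[of k "\<lambda>d. 0 < d \<and> z ^ d = 1"] that by (auto simp: d_def)
  have "z ^ n = (z ^ d) ^ (n div d) * z ^ (n mod d)"
    by (metis mult_div_mod_eq power_add power_mult)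
  then have "z ^ (n mod d) = 1" using z d by simp
  then have "d dvd n" using min[of "n mod d"] d by (auto simp: dvd_eq_mod_eq_0)
  then show "z \<in> (\<Union>d\<in>{d. d dvd n}. prim_roots d)"
    using d min by (auto simp: prim_roots_def)
next
  fix z assume "z \<in> (\<Union>d\<in>{d. d dvd n}. prim_roots d)"
  then show "z \<in> {z. z ^ n = 1}" by (auto simp: prim_roots_def power_mult elim!: dvdE)
qed

lemma prim_roots_disjoint:
  assumes "c > 0" "d > 0" "c \<noteq> d"
  shows "prim_roots c \<inter> prim_roots d = {}"
  using assms by (auto simp: prim_roots_def) (metis nat_neq_iff)

text \<open>Both sides have divisor sum n, so strong induction on n identifies them.\<close>

lemma card_prim_roots:
  assumes "n > 0"
  shows "card (prim_roots n) = totient n"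
  using assms
proof (induction n rule: less_induct)
  case (less n)
  have fin: "finite {d. d dvd n}" using less.prems by simp
  have pos: "d > 0" if "d dvd n" for d using that less.prems by (auto intro: Nat.gr0I)
  have "n = card (\<Union>d\<in>{d. d dvd n}. prim_roots d)"
    using card_nth_roots[of 1 n] less.prems prim_roots_Union[of n] by simp
  also have "\<dots> = (\<Sum>d | d dvd n. card (prim_roots d))"
    by (rule card_UN_disjoint) (use fin pos prim_roots_disjoint in auto)
  also have "\<dots> = card (prim_roots n) + (\<Sum>d\<in>{d. d dvd n} - {n}. card (prim_roots d))"
    by (rule sum.remove) (use fin in auto)
  also have "(\<Sum>d\<in>{d. d dvd n} - {n}. card (prim_roots d)) = (\<Sum>d\<in>{d. d dvd n} - {n}. totient d)"
    by (intro sum.cong refl less.IH)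
       (use less.prems pos in \<open>auto dest: dvd_imp_le intro: le_neq_trans\<close>)
  finally have "n = card (prim_roots n) + (\<Sum>d\<in>{d. d dvd n} - {n}. totient d)" .
  moreover have "n = totient n + (\<Sum>d\<in>{d. d dvd n} - {n}. totient d)"
    using totient_divisor_sum[of n] sum.remove[of "{d. d dvd n}" n totient] fin by simp
  ultimately show ?case by linarith
qed

text \<open>The homogenised cyclotomic polynomial \<open>\<Phi>\<^sub>n(X, b)\<close>.\<close>

definition cyclo :: "int \<Rightarrow> nat \<Rightarrow> complex poly" where
  "cyclo b n = (\<Prod>w\<in>prim_roots n. [:- (of_int b * w), 1:])"

lemma lead_coeff_cyclo: "lead_coeff (cyclo b n) = 1"
  by (simp add: cyclo_def lead_coeff_prod)

text \<open>Both polynomials are monic of degree n, so agreement at the n points b * w is enough;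
  these are distinct because b is nonzero.\<close>

lemma prod_roots_unity_poly:
  assumes "n > 0" "b \<noteq> 0"
  shows "(\<Prod>w | w ^ n = 1. [:- (b * w), 1:]) = monom 1 n - [:b ^ n :: complex:]" (is "?L = ?R")
proof -
  let ?S = "{w :: complex. w ^ n = 1}"
  have card: "card ?S = n" using card_nth_roots[of 1 n] assms by simp
  have fin: "finite ?S" using assms by (simp add: finite_nth_roots)
  have degL: "degree ?L = n"
    by (subst degree_prod_eq_sum_degree) (auto simp: card)
  have degR: "degree ?R = n"
    unfolding diff_conv_add_uminus using assms by (subst degree_add_eq_left) (auto simp: degree_monom_eq)
  show ?thesis
  proof (rule poly_eqI_degree_lead_coeff[where n = n and A = "(*) b ` ?S"])
    have "card ((*) b ` ?S) = n"
      using assms card by (subst card_image) (auto simp: inj_on_def)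
    then show "n \<le> card ((*) b ` ?S)" by simp
  next
    fix z assume "z \<in> (*) b ` ?S"
    then obtain w where w: "w \<in> ?S" "z = b * w" by auto
    have "poly ?L z = 0"
      unfolding poly_prod by (rule prod_zero) (use fin w in auto)
    moreover have "poly ?R z = 0"
      using w by (simp add: poly_monom power_mult_distrib)
    ultimately show "poly ?L z = poly ?R z" by simp
  next
    have "coeff ?L n = lead_coeff ?L" by (simp only: degL)
    also have "\<dots> = 1" by (simp add: lead_coeff_prod)
    also have "\<dots> = coeff ?R n" using assms by (simp add: coeff_pCons split: nat.splits)
    finally show "coeff ?L n = coeff ?R n" .
  qed (use degL degR in auto)
qed

lemma prod_cyclo:
  assumes "n > 0" "b \<noteq> 0"
  shows "(\<Prod>d | d dvd n. cyclo b d) = monom 1 n - [:of_int b ^ n:]"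
proof -
  have pos: "d > 0" if "d dvd n" for d using that assms by (auto intro: Nat.gr0I)
  have "(\<Prod>d | d dvd n. cyclo b d) = (\<Prod>w\<in>(\<Union>d\<in>{d. d dvd n}. prim_roots d). [:- (of_int b * w), 1:])"
    unfolding cyclo_def
    by (rule prod.UNION_disjoint[symmetric])
       (use assms prim_roots_disjoint[OF pos pos] in \<open>auto intro!: finite_prim_roots pos\<close>)
  also have "\<dots> = monom 1 n - [:of_int b ^ n:]"
    using prod_roots_unity_poly[of n "of_int b"] assms prim_roots_Union[of n] by simp
  finally show ?thesis .
qed

text \<open>X^n - b^n is integral, and by induction the factors for proper divisors of n form a
  monic integral polynomial, which can be cancelled.\<close>

lemma int_coeffs_cyclo:
  assumes "n > 0" "b \<noteq> 0"
  shows "int_coeffs (cyclo b n)"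
  using assms(1)
proof (induction n rule: less_induct)
  case (less n)
  let ?D = "{d. d dvd n} - {n}"
  let ?P = "\<Prod>d\<in>?D. cyclo b d"
  have P: "int_coeffs ?P"
    by (intro int_coeffs_prod less.IH)
       (use less.prems in \<open>auto dest: dvd_imp_le intro: le_neq_trans Nat.gr0I\<close>)
  have "?P * cyclo b n = (\<Prod>d | d dvd n. cyclo b d)"
    using less.prems by (subst prod.remove[of "{d. d dvd n}" n]) (auto simp: mult.commute)
  also have "\<dots> = monom 1 n - [:of_int b ^ n:]"
    by (rule prod_cyclo) (use less.prems assms in auto)
  also have "int_coeffs \<dots>"
    by (auto simp: int_coeffs_def coeff_pCons split: nat.splits)
  finally have "int_coeffs (?P * cyclo b n)" .
  then show ?case
    by (rule int_coeffs_monic_cancel[rotated 2])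
       (use P in \<open>auto simp: lead_coeff_prod lead_coeff_cyclo\<close>)
qed

text \<open>The number a^d - b^d is a product over e dividing d of the integers Phi_e(a, b). The
  prime divides one of them, which is nonzero because the whole product is, so p is at most its
  absolute value. That value is a product of phi(e) factors |a - b w| with |w| = 1, and phi(e) <=
  phi(d).\<close>

lemma prime_dvd_power_diff_le:
  fixes a b :: int
  assumes p: "prime p" and dvd: "int p dvd a ^ d - b ^ d" and ne: "a ^ d \<noteq> b ^ d"
    and b: "b \<noteq> 0" and d: "d > 0"
  shows "real p \<le> real_of_int (\<bar>a\<bar> + \<bar>b\<bar>) ^ totient d"
proof -
  have fin: "finite {e. e dvd d}" using d by simp
  have pos: "e > 0" if "e dvd d" for e using that d by (auto intro: Nat.gr0I)
  \<comment> \<open>The polynomial value is already an integer; real part and floor only change its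
    type.\<close>
  define N where "N = (\<lambda>e. \<lfloor>Re (poly (cyclo b e) (of_int a))\<rfloor>)"
  have N: "of_int (N e) = poly (cyclo b e) (of_int a)" if "e dvd d" for e
  proof -
    have "poly (cyclo b e) (of_int a) \<in> \<int>"
      using int_coeffs_cyclo[OF pos[OF that] b] by (intro int_coeffs_poly) auto
    then show ?thesis by (auto simp: N_def elim!: Ints_cases)
  qed
  have "of_int (\<Prod>e | e dvd d. N e) = (poly (\<Prod>e | e dvd d. cyclo b e) (of_int a) :: complex)"
    by (simp add: N poly_prod)
  also have "\<dots> = of_int (a ^ d - b ^ d)"
    using d b by (subst prod_cyclo) (auto simp: poly_monom)
  finally have prod: "(\<Prod>e | e dvd d. N e) = a ^ d - b ^ d"
    by (simp only: of_int_eq_iff)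
  have "prime (int p)" using p by simp
  then obtain e where e: "e dvd d" "int p dvd N e"
    using dvd prod fin by (metis (mono_tags, lifting) mem_Collect_eq prime_dvd_prod_iff)
  have "N e \<noteq> 0"
  proof
    assume "N e = 0"
    then have "(\<Prod>e | e dvd d. N e) = 0" using fin e by (intro prod_zero) auto
    then show False using prod ne by simp
  qed
  then have "int p \<le> \<bar>N e\<bar>" using e(2) by (simp add: zdvd_imp_le)
  then have "real p \<le> norm (of_int (N e) :: complex)" by simp
  also have "\<dots> = (\<Prod>w\<in>prim_roots e. norm (of_int a - of_int b * w))"
    by (simp add: N[OF e(1)] cyclo_def poly_prod prod_norm[symmetric])
  also have "\<dots> \<le> (\<Prod>w\<in>prim_roots e. real_of_int (\<bar>a\<bar> + \<bar>b\<bar>))"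
  proof (intro prod_mono conjI norm_ge_zero)
    fix w assume "w \<in> prim_roots e"
    then have "w ^ e = 1" by (simp add: prim_roots_def)
    then have "norm w ^ e = 1" by (metis norm_one norm_power)
    then have "norm w = 1" using pos[OF e(1)] by (metis norm_ge_zero one_power2 power_eq_imp_eq_base power_one zero_le_one)
    then show "norm (of_int a - of_int b * w) \<le> real_of_int (\<bar>a\<bar> + \<bar>b\<bar>)"
      using norm_triangle_ineq4[of "of_int a" "of_int b * w"] by (simp add: norm_mult)
  qed
  also have "\<dots> = real_of_int (\<bar>a\<bar> + \<bar>b\<bar>) ^ totient e"
    by (simp only: prod_constant card_prim_roots[OF pos[OF e(1)]])
  also have "\<dots> \<le> real_of_int (\<bar>a\<bar> + \<bar>b\<bar>) ^ totient d"
    by (intro power_increasing totient_dvd_mono) (use e d b in auto)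
  finally show ?thesis .
qed

section \<open>Divisor functions\<close>

definition tau_lists :: "nat \<Rightarrow> nat \<Rightarrow> nat list set" where
  "tau_lists k n = {xs. length xs = k \<and> (\<forall>x\<in>set xs. 0 < x) \<and> prod_list xs = n}"

lemma tau_eq_card: "tau k n = card (tau_lists k n)"
  by (simp add: tau_def tau_lists_def)

lemma tau_lists_subset:
  "tau_lists k n \<subseteq> {xs. set xs \<subseteq> {d. d dvd n} \<and> length xs = k}"
  by (auto simp: tau_lists_def prod_list_dvd)

lemma finite_tau_lists: "finite (tau_lists k n)"
proof (cases "n = 0")
  case True
  then have "tau_lists k n = {}" by (auto simp: tau_lists_def prod_list_zero_iff)
  then show ?thesis by simp
next
  case False
  then show ?thesis
    by (intro finite_subset[OF tau_lists_subset] finite_lists_length_eq) auto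
qed

lemma tau_le_power_divisors:
  assumes "n > 0"
  shows "tau k n \<le> card {d. d dvd n} ^ k"
  unfolding tau_eq_card
  using assms card_mono[OF _ tau_lists_subset[of k n]]
  by (simp add: card_lists_length_eq finite_lists_length_eq)

lemma tau_0: "tau 0 n = (if n = 1 then 1 else 0)"
proof -
  have "tau_lists 0 n = (if n = 1 then {[]} else {})" by (auto simp: tau_lists_def)
  then show ?thesis by (simp add: tau_eq_card)
qed

lemma tau_Suc:
  assumes "n > 0"
  shows "tau (Suc k) n = (\<Sum>d | d dvd n. tau k (n div d))"
proof -
  have "tau_lists (Suc k) n = (\<Union>d\<in>{d. d dvd n}. Cons d ` tau_lists k (n div d))"
  proof (intro equalityI subsetI)
    fix xs assume "xs \<in> tau_lists (Suc k) n"
    then obtain d ys where "xs = d # ys" "d > 0" "d * prod_list ys = n" "length ys = k"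
        "\<forall>x\<in>set ys. 0 < x"
      by (auto simp: tau_lists_def length_Suc_conv)
    then have "d dvd n" "ys \<in> tau_lists k (n div d)" "xs = d # ys"
      by (auto simp: tau_lists_def)
    then show "xs \<in> (\<Union>d\<in>{d. d dvd n}. Cons d ` tau_lists k (n div d))" by blast
  next
    fix xs assume "xs \<in> (\<Union>d\<in>{d. d dvd n}. Cons d ` tau_lists k (n div d))"
    then obtain d ys where d: "d dvd n" "ys \<in> tau_lists k (n div d)" "xs = d # ys" by blast
    have "d > 0" using d(1) assms by (intro Nat.gr0I) auto
    then show "xs \<in> tau_lists (Suc k) n" using d by (simp add: tau_lists_def)
  qed
  then have "tau (Suc k) n = (\<Sum>d | d dvd n. card (Cons d ` tau_lists k (n div d)))"
    unfolding tau_eq_card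
    by (subst card_UN_disjoint[symmetric]) (use assms finite_tau_lists in auto)
  also have "\<dots> = (\<Sum>d | d dvd n. tau k (n div d))"
    by (simp add: tau_eq_card card_image)
  finally show ?thesis .
qed

text \<open>The first entry z divides m * n, so it splits as x * y with x dividing m and y dividing
  n; cancel z and recurse. Hence every factorisation of m * n is an entrywise product of one of m
  and one of n, which is the source of submultiplicativity.\<close>

lemma tau_lists_mult_subset:
  "m > 0 \<Longrightarrow> n > 0 \<Longrightarrow> tau_lists k (m * n) \<subseteq> (\<lambda>(xs, ys). map2 (*) xs ys) ` (tau_lists k m \<times> tau_lists k n)"
proof (induction k arbitrary: m n)
  case 0
  then show ?case by (auto simp: tau_lists_def image_iff)
next
  case (Suc k)
  show ?case
  proof
    fix zs assume zs: "zs \<in> tau_lists (Suc k) (m * n)"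
    then obtain z zs' where z: "zs = z # zs'" "z > 0" "z * prod_list zs' = m * n"
        "length zs' = k" "\<forall>x\<in>set zs'. 0 < x"
      by (auto simp: tau_lists_def length_Suc_conv)
    then have "z dvd m * n" by (metis dvd_triv_left)
    then obtain x y where xy: "z = x * y" "x dvd m" "y dvd n"
      using division_decomp by blast
    then obtain m' n' where mn: "m = x * m'" "n = y * n'" by (auto elim!: dvdE)
    have "(x * m') * (y * n') = (x * y) * (m' * n')" by simp
    then have "z * prod_list zs' = z * (m' * n')" using z(3) xy(1) mn by metis
    then have "prod_list zs' = m' * n'" using z(2) by simp
    then have "zs' \<in> tau_lists k (m' * n')" using z by (simp add: tau_lists_def)
    moreover have "m' > 0" "n' > 0" using Suc.prems mn by auto
    ultimately have "zs' \<in> (\<lambda>(xs, ys). map2 (*) xs ys) ` (tau_lists k m' \<times> tau_lists k n')"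
      using subsetD[OF Suc.IH[of m' n']] by simp
    then obtain xs ys where xs: "zs' = map2 (*) xs ys" "xs \<in> tau_lists k m'" "ys \<in> tau_lists k n'"
      by (elim imageE) auto
    have pos: "x > 0" "y > 0" using z(2) xy(1) by auto
    have "x # xs \<in> tau_lists (Suc k) m"
      using xs(2) pos unfolding tau_lists_def mn(1) by simp
    moreover have "y # ys \<in> tau_lists (Suc k) n"
      using xs(3) pos unfolding tau_lists_def mn(2) by simp
    moreover have "zs = map2 (*) (x # xs) (y # ys)"
      by (simp only: z(1) xs(1) xy(1) zip_Cons_Cons list.map prod.case)
    ultimately show "zs \<in> (\<lambda>(xs, ys). map2 (*) xs ys) ` (tau_lists (Suc k) m \<times> tau_lists (Suc k) n)"
      by (intro image_eqI[of _ _ "(x # xs, y # ys)"]) auto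
  qed
qed

lemma tau_submult:
  assumes "m > 0" "n > 0"
  shows "tau k (m * n) \<le> tau k m * tau k n"
proof -
  have "tau k (m * n) \<le> card ((\<lambda>(xs, ys). map2 (*) xs ys) ` (tau_lists k m \<times> tau_lists k n))"
    unfolding tau_eq_card
    by (intro card_mono tau_lists_mult_subset assms finite_imageI finite_cartesian_product finite_tau_lists)
  also have "\<dots> \<le> card (tau_lists k m \<times> tau_lists k n)"
    by (intro card_image_le finite_cartesian_product finite_tau_lists)
  finally show ?thesis by (simp add: tau_eq_card card_cartesian_product)
qed

section \<open>The divisor bound: d(n) is at most a constant times n^\<epsilon>\<close>

lemma card_divisors_submult:
  fixes m n :: nat
  assumes "m > 0" "n > 0"
  shows "card {d. d dvd m * n} \<le> card {d. d dvd m} * card {d. d dvd n}"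
proof -
  have "{d. d dvd m * n} \<subseteq> (\<lambda>(x, y). x * y) ` ({d. d dvd m} \<times> {d. d dvd n})"
  proof
    fix d assume "d \<in> {d. d dvd m * n}"
    then obtain x y where "d = x * y" "x dvd m" "y dvd n" using division_decomp[of d m n] by blast
    then show "d \<in> (\<lambda>(x, y). x * y) ` ({d. d dvd m} \<times> {d. d dvd n})" by force
  qed
  then have "card {d. d dvd m * n} \<le> card ((\<lambda>(x, y). x * y) ` ({d. d dvd m} \<times> {d. d dvd n}))"
    by (intro card_mono finite_imageI finite_cartesian_product) (use assms in auto)
  also have "\<dots> \<le> card ({d. d dvd m} \<times> {d. d dvd n})"
    by (intro card_image_le finite_cartesian_product) (use assms in auto)
  finally show ?thesis by (simp add: card_cartesian_product)
qed

lemma card_divisors_prime_power: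
  fixes q :: nat
  assumes "prime q"
  shows "card {d. d dvd q ^ e} \<le> e + 1"
proof -
  have "{d. d dvd q ^ e} \<subseteq> (\<lambda>i. q ^ i) ` {..e}"
    using divides_primepow_nat[OF assms] by auto
  then have "card {d. d dvd q ^ e} \<le> card ((\<lambda>i. q ^ i) ` {..e})" by (intro card_mono) auto
  also have "\<dots> \<le> card {..e}" by (rule card_image_le) simp
  finally show ?thesis by simp
qed

text \<open>Removing one prime factor q >= B at most halves the divisor count, while n^\<epsilon>
  loses the factor q^\<epsilon> >= 2; no constant is lost.\<close>

lemma card_divisors_rough_le:
  fixes B :: nat
  assumes "\<epsilon> > 0" and B: "real B powr \<epsilon> \<ge> 2"
  shows "n > 0 \<Longrightarrow> (\<And>q. prime q \<Longrightarrow> q dvd n \<Longrightarrow> q \<ge> B) \<Longrightarrow> real (card {d. d dvd n}) \<le> real n powr \<epsilon>"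
proof (induction n rule: less_induct)
  case (less n)
  show ?case
  proof (cases "n = 1")
    case False
    then obtain q where q: "prime q" "q dvd n" by (metis prime_factor_nat)
    then obtain m where m: "n = q * m" by (auto elim: dvdE)
    have "m > 0" "m < n" using m less.prems(1) prime_gt_1_nat[OF q(1)] by auto
    then have IH: "real (card {d. d dvd m}) \<le> real m powr \<epsilon>"
      using less.IH[of m] less.prems(2) m by auto
    have "card {d. d dvd n} \<le> card {d. d dvd q} * card {d. d dvd m}"
      unfolding m using \<open>m > 0\<close> q by (intro card_divisors_submult) (auto simp: prime_gt_0_nat)
    also have "\<dots> \<le> 2 * card {d. d dvd m}"
      using card_divisors_prime_power[OF q(1), of 1] by simp
    finally have "real (card {d. d dvd n}) \<le> 2 * real (card {d. d dvd m})" by linarith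
    also have "\<dots> \<le> real q powr \<epsilon> * real m powr \<epsilon>"
    proof (intro mult_mono IH)
      have "real B powr \<epsilon> \<le> real q powr \<epsilon>"
        using less.prems(2)[OF q] assms by (intro powr_mono2) auto
      then show "2 \<le> real q powr \<epsilon>" using B by simp
    qed auto
    finally show ?thesis by (simp add: m powr_mult)
  qed simp
qed

text \<open>Bounds the contribution of a single prime power uniformly in the prime. With a =
  \<epsilon> ln 2, q^(e \<epsilon>) >= exp(a e) >= 1 + a e, and (1 + 1/a)(1 + a e) >= 1 + e.\<close>

lemma linear_le_exp_bound:
  assumes "\<epsilon> > 0"
  shows "\<exists>C\<ge>1. \<forall>q\<ge>2. \<forall>e. real (e + 1) \<le> C * real (q ^ e) powr \<epsilon>"
proof -
  define a where "a = \<epsilon> * ln 2"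
  have a: "a > 0" using assms by (simp add: a_def)
  have "real (e + 1) \<le> (1 + 1 / a) * real (q ^ e) powr \<epsilon>" if q: "q \<ge> 2" for q e :: nat
  proof -
    have "1 + a * real e \<le> exp (a * real e)" by (rule exp_ge_add_one_self)
    also have "\<dots> = (2 ^ e) powr \<epsilon>" by (simp add: a_def powr_def ln_realpow mult_ac)
    also have "\<dots> \<le> real (q ^ e) powr \<epsilon>"
      using assms q by (intro powr_mono2) (auto intro!: power_mono)
    finally have *: "1 + a * real e \<le> real (q ^ e) powr \<epsilon>" .
    have "(1 + 1 / a) * (1 + a * real e) = 1 + a * real e + 1 / a + real e"
      using a by (simp add: field_simps)
    moreover have "a * real e \<ge> 0" "1 / a \<ge> 0" using a by simp_all
    ultimately have "real (e + 1) \<le> (1 + 1 / a) * (1 + a * real e)" by simp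
    also have "\<dots> \<le> (1 + 1 / a) * real (q ^ e) powr \<epsilon>"
      using a * by (intro mult_left_mono) auto
    finally show ?thesis .
  qed
  then show ?thesis using a by (intro exI[of _ "1 + 1 / a"]) auto
qed

text \<open>Only the finitely many primes q with q^\<epsilon> < 2 can make the divisor count outgrow
  n^\<epsilon>. Each is stripped from n with its full power at the cost of one constant factor, and
  the rest of n is covered by \<open>card_divisors_rough_le\<close>.\<close>

lemma divisor_bound:
  assumes \<epsilon>: "\<epsilon> > 0"
  shows "\<exists>C\<ge>1. \<forall>n>0. real (card {d. d dvd n}) \<le> C * real n powr \<epsilon>"
proof -
  define B where "B = nat \<lceil>2 powr (1 / \<epsilon>)\<rceil>"
  have "2 powr (1 / \<epsilon>) \<le> real B" by (simp add: B_def real_nat_ceiling_ge)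
  then have "(2 powr (1 / \<epsilon>)) powr \<epsilon> \<le> real B powr \<epsilon>" using \<epsilon> by (intro powr_mono2) auto
  then have B: "real B powr \<epsilon> \<ge> 2" using \<epsilon> by (simp add: powr_powr)
  obtain c where c: "c \<ge> 1" "\<And>q e. q \<ge> 2 \<Longrightarrow> real (e + 1) \<le> c * real (q ^ e) powr \<epsilon>"
    using linear_le_exp_bound[OF \<epsilon>] by blast
  \<comment> \<open>S is the set of small primes allowed to divide n; the induction pays one factor
    c for each of them.\<close>
  have main: "\<forall>n>0. (\<forall>q. prime q \<longrightarrow> q dvd n \<longrightarrow> q \<ge> B \<or> q \<in> S) \<longrightarrow>
      real (card {d. d dvd n}) \<le> c ^ card S * real n powr \<epsilon>" if "finite S" "\<forall>q\<in>S. prime q" for S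
    using that
  proof (induction S rule: finite_induct)
    case empty
    then show ?case using card_divisors_rough_le[OF \<epsilon> B] by auto
  next
    case (insert q S)
    show ?case
    proof (intro allI impI)
      fix n :: nat assume n: "n > 0" "\<forall>r. prime r \<longrightarrow> r dvd n \<longrightarrow> r \<ge> B \<or> r \<in> insert q S"
      have q: "prime q" using insert.prems by simp
      have "n \<noteq> 0" "\<not> is_unit q" using n q not_prime_unit by auto
      then obtain m where m: "n = q ^ multiplicity q n * m" "\<not> q dvd m"
        using multiplicity_decompose'[of n q] by blast
      define e where "e = multiplicity q n"
      note m = m[folded e_def]
      have "m > 0" using m n by auto
      have "r \<ge> B \<or> r \<in> S" if "prime r" "r dvd m" for r
        using n(2)[rule_format, of r] that m by auto
      then have IH: "real (card {d. d dvd m}) \<le> c ^ card S * real m powr \<epsilon>"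
        using insert.IH insert.prems \<open>m > 0\<close> by auto
      have "card {d. d dvd n} \<le> card {d. d dvd q ^ e} * card {d. d dvd m}"
        unfolding m(1) using \<open>m > 0\<close> q by (intro card_divisors_submult) (auto simp: prime_gt_0_nat)
      also have "\<dots> \<le> (e + 1) * card {d. d dvd m}"
        using card_divisors_prime_power[OF q, of e] by (intro mult_right_mono) auto
      finally have "real (card {d. d dvd n}) \<le> real (e + 1) * real (card {d. d dvd m})"
        by (metis of_nat_le_iff of_nat_mult)
      also have "\<dots> \<le> (c * real (q ^ e) powr \<epsilon>) * (c ^ card S * real m powr \<epsilon>)"
        using c(1) by (intro mult_mono IH c(2)) (use q in \<open>auto simp: prime_ge_2_nat\<close>)
      also have "\<dots> = c ^ card (insert q S) * real n powr \<epsilon>"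
        using insert.hyps by (simp add: m(1) powr_mult)
      finally show "real (card {d. d dvd n}) \<le> c ^ card (insert q S) * real n powr \<epsilon>" .
    qed
  qed
  define S where "S = {q. prime q \<and> q < B}"
  have "finite S" by (simp add: S_def)
  then show ?thesis
  proof (intro exI[of _ "c ^ card S"] conjI allI impI)
    fix n :: nat assume "n > 0"
    moreover have "\<forall>q. prime q \<longrightarrow> q dvd n \<longrightarrow> q \<ge> B \<or> q \<in> S" by (auto simp: S_def)
    ultimately show "real (card {d. d dvd n}) \<le> c ^ card S * real n powr \<epsilon>"
      using main[OF \<open>finite S\<close>] by (auto simp: S_def)
  qed (use c in simp)
qed

lemma tau_bound:
  assumes \<epsilon>: "\<epsilon> > 0"
  shows "\<exists>C\<ge>1. \<forall>n>0. real (tau k n) \<le> C * real n powr \<epsilon>"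
proof -
  \<comment> \<open>The exponent is divided by \<open>Suc k\<close> rather than k so that the choice
    also works for k = 0.\<close>
  obtain C where C: "C \<ge> 1" "\<And>n. n > 0 \<Longrightarrow> real (card {d. d dvd n}) \<le> C * real n powr (\<epsilon> / real (Suc k))"
    using divisor_bound[of "\<epsilon> / real (Suc k)"] \<epsilon> by auto
  show ?thesis
  proof (intro exI[of _ "C ^ k"] conjI allI impI)
    fix n :: nat assume n: "n > 0"
    have "real (tau k n) \<le> real (card {d. d dvd n}) ^ k"
      using tau_le_power_divisors[OF n, of k] by (metis of_nat_le_iff of_nat_power)
    also have "\<dots> \<le> (C * real n powr (\<epsilon> / real (Suc k))) ^ k"
      by (intro power_mono C n) auto
    also have "\<dots> = C ^ k * real n powr (real k * (\<epsilon> / real (Suc k)))"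
      using n by (simp add: power_mult_distrib powr_realpow[symmetric] powr_powr mult_ac)
    also have "\<dots> \<le> C ^ k * real n powr \<epsilon>"
      using n \<epsilon> C(1) by (intro mult_left_mono powr_mono) (auto simp: field_simps)
    finally show "real (tau k n) \<le> C ^ k * real n powr \<epsilon>" .
  qed (use C in auto)
qed

section \<open>Logarithmic means of tau_k and of products of two such functions\<close>

definition harm_sum :: "nat \<Rightarrow> real" where
  "harm_sum N = (\<Sum>n = 1..N. 1 / real n)"

lemma harm_sum_le: "N \<ge> 1 \<Longrightarrow> harm_sum N \<le> 1 + ln (real N)"
proof (induction N rule: dec_induct)
  case base
  then show ?case by (simp add: harm_sum_def)
next
  case (step N)
  have "1 / real (Suc N) \<le> ln (real (Suc N)) - ln (real N)"
  proof -
    have "ln (real N / real (Suc N)) \<le> real N / real (Suc N) - 1"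
      using step by (intro ln_le_minus_one) auto
    also have "\<dots> = - (1 / real (Suc N))" by (simp add: field_simps)
    finally show ?thesis using step by (simp add: ln_div)
  qed
  then show ?case using step.IH by (simp add: harm_sum_def)
qed

text \<open>The left side runs over pairs (d, e) with d * e <= N. These lie in the square of side N,
  and by nonnegativity the additional pairs only enlarge the sum.\<close>

lemma sum_divisors_le_mult:
  fixes f g :: "nat \<Rightarrow> real"
  assumes "\<And>n. f n \<ge> 0" "\<And>n. g n \<ge> 0"
  shows "(\<Sum>n = 1..N. \<Sum>d | d dvd n. f d * g (n div d)) \<le> (\<Sum>n = 1..N. f n) * (\<Sum>n = 1..N. g n)"
proof -
  have "(\<Sum>n = 1..N. \<Sum>d | d dvd n. f d * g (n div d))
      = (\<Sum>(n, d)\<in>(SIGMA n:{1..N}. {d. d dvd n}). f d * g (n div d))"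
    by (rule sum.Sigma) auto
  also have "\<dots> \<le> (\<Sum>(d, e)\<in>{1..N} \<times> {1..N}. f d * g e)"
  proof (rule sum_le_included[where i = "\<lambda>(d, e). (d * e, d)"])
    show "\<forall>x\<in>SIGMA n:{1..N}. {d. d dvd n}. \<exists>y\<in>{1..N} \<times> {1..N}.
        (case y of (d, e) \<Rightarrow> (d * e, d)) = x \<and>
        (case x of (n, d) \<Rightarrow> f d * g (n div d)) \<le> (case y of (d, e) \<Rightarrow> f d * g e)"
    proof clarify
      fix n d assume n: "n \<in> {1..N}" "d dvd n"
      then obtain e where e: "n = d * e" by (auto elim: dvdE)
      have "n > 0" "n \<le> N" using n by auto
      moreover have "d \<le> n" "e \<le> n" using \<open>n > 0\<close> e by (auto intro: dvd_imp_le)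
      moreover have "d > 0" "e > 0" using \<open>n > 0\<close> e by (auto intro!: Nat.gr0I)
      ultimately have "d \<in> {1..N}" "e \<in> {1..N}" by simp_all
      then show "\<exists>y\<in>{1..N} \<times> {1..N}. (case y of (d, e) \<Rightarrow> (d * e, d)) = (n, d) \<and>
          f d * g (n div d) \<le> (case y of (d, e) \<Rightarrow> f d * g e)"
        using e by (intro bexI[of _ "(d, e)"]) auto
    qed
  qed (use assms in \<open>auto intro: finite_SigmaI\<close>)
  also have "\<dots> = (\<Sum>n = 1..N. f n) * (\<Sum>n = 1..N. g n)"
    by (simp add: sum_product sum.cartesian_product)
  finally show ?thesis .
qed

text \<open>tau_k(n)/n is the k-fold Dirichlet convolution of 1/n, so each factor costs one harmonic
  sum.\<close>

lemma sum_tau_le: "(\<Sum>n = 1..N. real (tau k n) / real n) \<le> harm_sum N ^ k"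
proof (induction k)
  case 0
  have "(\<Sum>n = 1..N. real (tau 0 n) / real n) = (\<Sum>n \<in> {1..N}. if n = 1 then 1 else 0)"
    by (intro sum.cong) (auto simp: tau_0)
  also have "\<dots> \<le> 1" by (subst sum.delta) auto
  finally show ?case by simp
next
  case (Suc k)
  have "(\<Sum>n = 1..N. real (tau (Suc k) n) / real n)
      = (\<Sum>n = 1..N. \<Sum>d | d dvd n. (1 / real d) * (real (tau k (n div d)) / real (n div d)))"
  proof (intro sum.cong refl)
    fix n assume n: "n \<in> {1..N}"
    then have "real (tau (Suc k) n) / real n = (\<Sum>d | d dvd n. real (tau k (n div d)) / real n)"
      by (simp add: tau_Suc sum_divide_distrib)
    also have "\<dots> = (\<Sum>d | d dvd n. (1 / real d) * (real (tau k (n div d)) / real (n div d)))"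
      by (intro sum.cong refl) (use n in \<open>auto simp: real_of_nat_div\<close>)
    finally show "real (tau (Suc k) n) / real n = \<dots>" .
  qed
  also have "\<dots> \<le> (\<Sum>n = 1..N. 1 / real n) * (\<Sum>n = 1..N. real (tau k n) / real n)"
    by (rule sum_divisors_le_mult[where f = "\<lambda>d. 1 / real d" and g = "\<lambda>n. real (tau k n) / real n"]) auto
  also have "\<dots> \<le> harm_sum N * harm_sum N ^ k"
    using Suc.IH by (auto simp: harm_sum_def intro!: mult_left_mono sum_nonneg)
  finally show ?case by simp
qed

text \<open>Peel one factor d off tau_(j+1)(n) and use tau_k(n) <= tau_k(d) tau_k(n/d): each step in
  j costs the mean of tau_k(d)/d, which is at most \<open>harm_sum N ^ k\<close>. The case j = k
  yields the exponent k^2.\<close>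

lemma sum_tau_tau_le: "(\<Sum>n = 1..N. real (tau j n) * real (tau k n) / real n) \<le> harm_sum N ^ (j * k)"
proof (induction j)
  case 0
  have "tau k (Suc 0) = 1"
  proof -
    have "xs = replicate k 1" if "xs \<in> tau_lists k 1" for xs
    proof -
      have *: "\<forall>x\<in>set xs. x = 1"
      proof
        fix x assume "x \<in> set xs"
        then have "x dvd prod_list xs" by (rule prod_list_dvd)
        moreover have "prod_list xs = 1" using that by (simp add: tau_lists_def)
        ultimately show "x = 1" by simp
      qed
      show ?thesis by (rule replicate_eqI) (use that * in \<open>auto simp: tau_lists_def\<close>)
    qed
    moreover have "replicate k 1 \<in> tau_lists k 1" by (simp add: tau_lists_def)
    ultimately have "tau_lists k 1 = {replicate k 1}" by blast
    then show ?thesis by (simp add: tau_eq_card)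
  qed
  then have "(\<Sum>n = 1..N. real (tau 0 n) * real (tau k n) / real n) = (\<Sum>n \<in> {1..N}. if n = 1 then 1 else 0)"
    by (intro sum.cong) (auto simp: tau_0)
  also have "\<dots> \<le> 1" by (subst sum.delta) auto
  finally show ?case by simp
next
  case (Suc j)
  have "(\<Sum>n = 1..N. real (tau (Suc j) n) * real (tau k n) / real n)
      \<le> (\<Sum>n = 1..N. \<Sum>d | d dvd n. (real (tau k d) / real d) *
           (real (tau j (n div d)) * real (tau k (n div d)) / real (n div d)))"
  proof (rule sum_mono)
    fix n assume n: "n \<in> {1..N}"
    have "real (tau (Suc j) n) * real (tau k n) / real n
        = (\<Sum>d | d dvd n. real (tau j (n div d)) * real (tau k n) / real n)"
      using n by (simp add: tau_Suc sum_divide_distrib sum_distrib_right)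
    also have "\<dots> \<le> (\<Sum>d | d dvd n. (real (tau k d) / real d) *
           (real (tau j (n div d)) * real (tau k (n div d)) / real (n div d)))"
    proof (rule sum_mono)
      fix d assume "d \<in> {d. d dvd n}"
      then obtain e where e: "n = d * e" by (auto elim: dvdE)
      have pos: "d > 0" "e > 0" using e n by auto
      have "real (tau k n) \<le> real (tau k d) * real (tau k e)"
        using tau_submult[OF pos, of k] e by (metis of_nat_le_iff of_nat_mult)
      then have "real (tau j e) * real (tau k n) / (real d * real e)
           \<le> real (tau j e) * (real (tau k d) * real (tau k e)) / (real d * real e)"
        by (intro divide_right_mono mult_left_mono) auto
      then show "real (tau j (n div d)) * real (tau k n) / real n
          \<le> (real (tau k d) / real d) *
           (real (tau j (n div d)) * real (tau k (n div d)) / real (n div d))"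
        using pos e by (simp add: mult_ac)
    qed
    finally show "real (tau (Suc j) n) * real (tau k n) / real n \<le> \<dots>" .
  qed
  also have "\<dots> \<le> (\<Sum>n = 1..N. real (tau k n) / real n) * (\<Sum>n = 1..N. real (tau j n) * real (tau k n) / real n)"
    by (rule sum_divisors_le_mult[where f = "\<lambda>d. real (tau k d) / real d"
          and g = "\<lambda>n. real (tau j n) * real (tau k n) / real n"]) auto
  also have "\<dots> \<le> harm_sum N ^ k * harm_sum N ^ (j * k)"
    by (intro mult_mono Suc.IH sum_tau_le) (auto simp: harm_sum_def intro!: sum_nonneg zero_le_power)
  finally show ?case by (simp add: power_add)
qed

section \<open>Odd characters trivial on the subgroup\<close>

lemma carrier_Fp_star: "p > 0 \<Longrightarrow> carrier (Fp_star p) = {1..int p - 1}"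
  by (auto simp: Fp_star_def mult_of_def residue_ring_def)

lemma mult_Fp_star: "x \<otimes>\<^bsub>Fp_star p\<^esub> y = x * y mod int p"
  by (simp add: Fp_star_def residue_ring_def)

lemma one_Fp_star: "\<one>\<^bsub>Fp_star p\<^esub> = 1"
  by (simp add: Fp_star_def residue_ring_def)

lemma comm_group_Fp_star:
  assumes "prime p"
  shows "comm_group (Fp_star p)"
proof -
  interpret residues_prime p "residue_ring (int p)"
    using assms by (unfold_locales) auto
  show ?thesis
    unfolding Fp_star_def field.mult_of_is_Units[OF is_field] by (rule comm_monoid.units_comm_group[OF comm_monoid])
qed

lemma pow_Fp_star:
  assumes "prime p" "x \<in> carrier (Fp_star p)"
  shows "x [^]\<^bsub>Fp_star p\<^esub> (n :: nat) = x ^ n mod int p"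
proof -
  interpret residues_prime p "residue_ring (int p)"
    using assms by (unfold_locales) auto
  have "x mod int p = x" using assms by (auto simp: carrier_Fp_star prime_gt_0_nat)
  then show ?thesis
    using pow_cong[of x n] by (simp add: Fp_star_def nat_pow_mult_of)
qed

lemma neg_one_residue_ring:
  assumes "prime p"
  shows "\<ominus>\<^bsub>residue_ring (int p)\<^esub> \<one>\<^bsub>residue_ring (int p)\<^esub> = int p - 1"
proof -
  interpret residues_prime p "residue_ring (int p)"
    using assms by (unfold_locales) auto
  have "(- 1) mod int p = int p - 1"
    using prime_gt_1_nat[OF assms] by (simp add: zmod_minus1)
  then show ?thesis using res_neg_eq[of 1] by (simp add: res_one_eq)
qed

text \<open>Used to show that any subgroup of order d lies inside the d-torsion, which makes it
  unique.\<close>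

lemma (in group) pow_card_subgroup_eq_one:
  assumes "subgroup H G" "finite H" "x \<in> H"
  shows "x [^] card H = \<one>"
proof -
  interpret H: group "G\<lparr>carrier := H\<rparr>"
    using assms(1) by (rule subgroup.subgroup_is_group) (rule is_group)
  have "x [^]\<^bsub>G\<lparr>carrier := H\<rparr>\<^esub> card H = \<one>"
    using H.pow_order_eq_1[of x] assms(2,3) by (simp add: Coset.order_def)
  then show ?thesis using nat_pow_consistent[of x "card H" H] by metis
qed

text \<open>The index is m = 2h. It is even because p - 1 is even and d is odd, and h turns out to
  be the number of odd characters trivial on the subgroup. The generator g is fixed so that
  characters become powers of a single complex number.\<close>

locale odd_order_residues =
  fixes p h d g :: nat
  assumes prime_p: "prime p" and p_eq: "p - 1 = 2 * (h * d)"
    and odd_d: "odd d" and primroot: "residue_primroot p g"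
begin

abbreviation "m \<equiv> 2 * h"

lemma md: "m * d = p - 1"
  by (simp only: p_eq mult.assoc)

lemma h_pos: "h > 0" and d_pos: "d > 0"
  using p_eq prime_gt_1_nat[OF prime_p] by (auto intro!: Nat.gr0I)

lemma m_pos: "m > 0"
  using h_pos by simp

lemma p_gt_2: "p > 2"
proof -
  have "p - 1 \<ge> 2" unfolding p_eq using h_pos d_pos by simp
  then show ?thesis by simp
qed

lemma coprime_g: "coprime p g" and ord_g: "ord p g = p - 1"
  using primroot prime_p by (auto simp: residue_primroot_def totient_prime)

lemma not_dvd_g: "\<not> p dvd g ^ i"
proof
  assume "p dvd g ^ i"
  then have "p dvd g" using prime_p prime_dvd_power by blast
  then have "is_unit p" using coprime_g by (simp add: coprime_absorb_left)
  then show False using prime_p not_prime_unit by blast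
qed

lemma g_power_cong_iff: "[g ^ i = g ^ j] (mod p) \<longleftrightarrow> [i = j] (mod (p - 1))"
  using order_divides_expdiff[OF coprime_g] ord_g by simp

lemma g_power_eq_1_iff: "[g ^ i = 1] (mod p) \<longleftrightarrow> p - 1 dvd i"
  using g_power_cong_iff[of i 0] by (simp add: cong_0_iff)

lemma log_exists:
  assumes "\<not> p dvd n"
  shows "\<exists>i. [n = g ^ i] (mod p)"
proof -
  have "n mod p \<in> totatives p"
    using assms prime_p by (auto simp: totatives_prime dvd_eq_mod_eq_0 prime_gt_0_nat)
  then obtain i where "n mod p = g ^ i mod p"
    using residue_primroot_is_generator[OF prime_gt_1_nat[OF prime_p] primroot]
    by (auto simp: bij_betw_def)
  then show ?thesis by (auto simp: cong_def)
qed

abbreviation "G \<equiv> Fp_star p"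

lemma carrier_G: "carrier G = {1..int p - 1}"
  using p_gt_2 by (simp add: carrier_Fp_star)

sublocale G: comm_group G
  by (rule comm_group_Fp_star[OF prime_p])

lemma finite_G: "finite (carrier G)"
  by (simp add: carrier_G)

text \<open>The explicit form of the group that the definite description
  \<open>index_subgroup p m\<close> denotes.\<close>

definition torsion :: "int set" where
  "torsion = {x \<in> carrier G. x [^]\<^bsub>G\<^esub> d = \<one>\<^bsub>G\<^esub>}"

lemma of_nat_in_G: "\<not> p dvd n \<Longrightarrow> int (n mod p) \<in> carrier G"
  using p_gt_2 by (auto simp: carrier_G dvd_eq_mod_eq_0 Suc_le_eq simp del: of_nat_mod)

lemma in_torsion_iff:
  assumes "\<not> p dvd n"
  shows "int (n mod p) \<in> torsion \<longleftrightarrow> [n ^ d = 1] (mod p)"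
proof -
  have "int (n mod p) \<in> torsion \<longleftrightarrow> int (n mod p) ^ d mod int p = 1"
    using of_nat_in_G[OF assms] pow_Fp_star[OF prime_p] by (simp add: torsion_def one_Fp_star)
  also have "\<dots> \<longleftrightarrow> (n mod p) ^ d mod p = 1"
  proof -
    have "int (n mod p) ^ d mod int p = int ((n mod p) ^ d mod p)" by (simp only: of_nat_mod of_nat_power)
    then show ?thesis by (simp only: of_nat_eq_1_iff)
  qed
  also have "\<dots> \<longleftrightarrow> [n ^ d = 1] (mod p)"
    using p_gt_2 by (simp add: cong_def power_mod)
  finally show ?thesis .
qed

lemma subgroup_torsion: "subgroup torsion G"
proof (rule G.subgroupI)
  show "torsion \<noteq> {}" by (auto simp: torsion_def intro!: exI[of _ "\<one>\<^bsub>G\<^esub>"])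
next
  fix a b assume "a \<in> torsion" "b \<in> torsion"
  then show "a \<otimes>\<^bsub>G\<^esub> b \<in> torsion" by (simp add: torsion_def G.pow_mult_distrib[OF G.m_comm])
qed (auto simp: torsion_def G.nat_pow_inv)

text \<open>At most d elements because x^d = 1 has at most d roots modulo a prime; at least d
  because the powers g^(m j) with j < d are distinct.\<close>

lemma card_torsion: "card torsion = d"
proof (rule antisym)
  have "torsion \<subseteq> int ` {x \<in> {..<p}. [x ^ d = 1] (mod p)}"
  proof
    fix x assume x: "x \<in> torsion"
    then have "x = int (nat x)" "nat x < p" "nat x > 0" by (auto simp: torsion_def carrier_G)
    moreover from this have "\<not> p dvd nat x" by (auto dest: dvd_imp_le)
    ultimately show "x \<in> int ` {x \<in> {..<p}. [x ^ d = 1] (mod p)}"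
      using x in_torsion_iff[of "nat x"] by (intro image_eqI[of _ _ "nat x"]) auto
  qed
  then have "card torsion \<le> card (int ` {x \<in> {..<p}. [x ^ d = 1] (mod p)})"
    by (intro card_mono) auto
  also have "\<dots> \<le> card {x \<in> {..<p}. [x ^ d = 1] (mod p)}" by (rule card_image_le) auto
  also have "\<dots> \<le> d" by (rule roots_mod_prime_bound[OF prime_p d_pos])
  finally show "card torsion \<le> d" .
next
  let ?f = "\<lambda>j. int (g ^ (m * j) mod p)"
  have "inj_on ?f {..<d}"
  proof (rule inj_onI)
    fix i j assume ij: "i \<in> {..<d}" "j \<in> {..<d}" "?f i = ?f j"
    then have "[g ^ (m * i) = g ^ (m * j)] (mod p)" by (simp add: cong_def)
    then have "[m * i = m * j] (mod (p - 1))" by (simp add: g_power_cong_iff)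
    moreover have "m * i < p - 1" "m * j < p - 1" using ij m_pos md[symmetric] by auto
    ultimately have "m * i = m * j" by (simp add: cong_def)
    then show "i = j" using m_pos by simp
  qed
  then have "d = card (?f ` {..<d})" by (simp add: card_image)
  also have "\<dots> \<le> card torsion"
  proof (intro card_mono)
    show "finite torsion" using finite_G by (simp add: torsion_def)
    show "?f ` {..<d} \<subseteq> torsion"
    proof clarify
      fix j
      have "[(g ^ (m * j)) ^ d = 1] (mod p)"
        unfolding power_mult[symmetric] g_power_eq_1_iff md[symmetric] by simp
      then show "?f j \<in> torsion" by (simp only: in_torsion_iff[OF not_dvd_g])
    qed
  qed
  finally show "d \<le> card torsion" .
qed

text \<open>By Lagrange a subgroup of index m has order d, so its elements are killed by d and it
  lies in \<open>torsion\<close>, which has the same size.\<close>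

lemma index_subgroup_eq_torsion: "index_subgroup p m = torsion"
  unfolding index_subgroup_def
proof (rule the_equality)
  have ord: "Coset.order G = m * d" using p_gt_2 md by (simp add: Coset.order_def carrier_G)
  have "card (rcosets\<^bsub>G\<^esub> torsion) * d = m * d"
    using G.lagrange[OF subgroup_torsion] card_torsion ord by simp
  then show "subgroup torsion G \<and> card (rcosets\<^bsub>G\<^esub> torsion) = m"
    using subgroup_torsion d_pos by simp
  fix H assume H: "subgroup H G \<and> card (rcosets\<^bsub>G\<^esub> H) = m"
  then have "m * card H = m * d" using G.lagrange[of H] ord by simp
  then have card: "card H = d" using m_pos by simp
  have sub: "H \<subseteq> carrier G" using H subgroup.subset by blast
  then have fin: "finite H" using finite_G finite_subset by blast
  have "H \<subseteq> torsion"
    using G.pow_card_subgroup_eq_one[of H] H fin card sub by (auto simp: torsion_def)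
  then show "H = torsion"
    using card card_torsion finite_G by (intro card_subset_eq) (auto simp: torsion_def)
qed

section \<open>Characters, their extensions to the natural numbers, and their values at g\<close>

lemma hom_mult:
  assumes "\<chi> \<in> mult_characters p" "x \<in> carrier G" "y \<in> carrier G"
  shows "\<chi> (x * y mod int p) = \<chi> x * \<chi> y"
proof -
  have "\<chi> \<in> hom G complex_star" using assms by (simp add: mult_characters_def)
  then show ?thesis
    using assms(2,3) by (auto simp: hom_def mult_Fp_star complex_star_def)
qed

lemma hom_nonzero:
  assumes "\<chi> \<in> mult_characters p" "x \<in> carrier G"
  shows "\<chi> x \<noteq> 0"
proof -
  have "\<chi> \<in> hom G complex_star" using assms by (simp add: mult_characters_def)
  then show ?thesis using assms(2) by (auto simp: hom_def complex_star_def)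
qed

lemma dirichlet_ext_mod: "dirichlet_ext p \<chi> (n mod p) = dirichlet_ext p \<chi> n"
  by (simp add: dirichlet_ext_def of_nat_mod dvd_mod_iff)

lemma dirichlet_ext_cong: "[a = b] (mod p) \<Longrightarrow> dirichlet_ext p \<chi> a = dirichlet_ext p \<chi> b"
  by (metis cong_def dirichlet_ext_mod)

lemma dirichlet_ext_mult:
  assumes "\<chi> \<in> mult_characters p"
  shows "dirichlet_ext p \<chi> (a * b) = dirichlet_ext p \<chi> a * dirichlet_ext p \<chi> b"
proof (cases "p dvd a \<or> p dvd b")
  case True
  then show ?thesis by (auto simp: dirichlet_ext_def)
next
  case False
  then have "\<not> p dvd a * b" using prime_p by (simp add: prime_dvd_mult_iff)
  moreover have "int a mod int p \<in> carrier G" "int b mod int p \<in> carrier G"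
    using of_nat_in_G[of a] of_nat_in_G[of b] False by (auto simp: of_nat_mod)
  ultimately show ?thesis
    using False hom_mult[OF assms, of "int a mod int p" "int b mod int p"]
    by (simp add: dirichlet_ext_def mod_mult_eq)
qed

lemma dirichlet_ext_1:
  assumes "\<chi> \<in> mult_characters p"
  shows "dirichlet_ext p \<chi> 1 = 1"
proof -
  have "dirichlet_ext p \<chi> 1 * dirichlet_ext p \<chi> 1 = dirichlet_ext p \<chi> 1"
    using dirichlet_ext_mult[OF assms, of 1 1] by simp
  moreover have "dirichlet_ext p \<chi> 1 \<noteq> 0"
    using hom_nonzero[OF assms, of 1] p_gt_2 by (simp add: dirichlet_ext_def carrier_G)
  ultimately show ?thesis by simp
qed

lemma dirichlet_ext_power:
  assumes "\<chi> \<in> mult_characters p"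
  shows "dirichlet_ext p \<chi> (a ^ i) = dirichlet_ext p \<chi> a ^ i"
  by (induction i) (use assms in \<open>simp_all add: dirichlet_ext_mult dirichlet_ext_1[simplified]\<close>)

lemma dirichlet_ext_carrier:
  assumes "x \<in> carrier G"
  shows "dirichlet_ext p \<chi> (nat x) = \<chi> x"
proof -
  have "\<not> p dvd nat x" using assms p_gt_2 by (auto simp: carrier_G dest: dvd_imp_le)
  then show ?thesis using assms by (simp add: dirichlet_ext_def carrier_G)
qed

text \<open>The exponent is (p - 1)/2: the power squares to 1 but is not 1, since g has order p - 1.
  This expresses \<chi>(-1) through \<chi>(g).\<close>

lemma g_power_half: "[g ^ (h * d) = p - 1] (mod p)"
proof -
  let ?x = "int (g ^ (h * d))"
  have "[g ^ (h * d) * g ^ (h * d) = 1] (mod p)"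
    unfolding power_add[symmetric] g_power_eq_1_iff p_eq mult_2[symmetric] by (rule dvd_refl)
  then have "[int (g ^ (h * d) * g ^ (h * d)) = int 1] (mod int p)" by (simp only: cong_int_iff)
  then have "[?x * ?x = 1] (mod int p)" by (simp only: of_nat_mult of_nat_1)
  then have "int p dvd ?x * ?x - 1" by (simp add: cong_iff_dvd_diff)
  then have "int p dvd (?x - 1) * (?x + 1)" by (simp add: algebra_simps)
  moreover have "prime (int p)" using prime_p by simp
  ultimately have "int p dvd ?x - 1 \<or> int p dvd ?x + 1" by (rule prime_dvd_multD[rotated])
  moreover have "\<not> int p dvd ?x - 1"
  proof
    assume "int p dvd ?x - 1"
    then have "[int (g ^ (h * d)) = int 1] (mod int p)" by (simp add: cong_iff_dvd_diff)
    then have "[g ^ (h * d) = 1] (mod p)" by (simp only: cong_int_iff)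
    then have "p - 1 dvd h * d" by (simp only: g_power_eq_1_iff)
    then show False using p_eq h_pos d_pos by (auto dest!: dvd_imp_le)
  qed
  ultimately have "int p dvd ?x + 1" by blast
  then have "int p dvd ?x + 1 - int p" by simp
  then have "[?x = int (p - 1)] (mod int p)"
    using p_gt_2 by (simp add: cong_iff_dvd_diff of_nat_diff algebra_simps)
  then show ?thesis by (simp only: cong_int_iff)
qed

lemma odd_characters_mult: "\<chi> \<in> odd_characters p m \<Longrightarrow> \<chi> \<in> mult_characters p"
  by (simp add: odd_characters_def characters_trivial_on_def)

lemma dirichlet_ext_minus_1:
  assumes "\<chi> \<in> odd_characters p m"
  shows "dirichlet_ext p \<chi> (p - 1) = -1"
proof -
  have "\<chi> (int p - 1) = -1"
    using assms neg_one_residue_ring[OF prime_p] by (simp add: odd_characters_def)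
  then show ?thesis
    using dirichlet_ext_carrier[of "int p - 1" \<chi>] p_gt_2
    by (simp add: carrier_G nat_diff_distrib)
qed

lemma dirichlet_ext_reflect:
  assumes "\<chi> \<in> odd_characters p m" "r \<le> p"
  shows "dirichlet_ext p \<chi> (p - r) = - dirichlet_ext p \<chi> r"
proof -
  have "int ((p - 1) * r) - int (p - r) = int p * (int r - 1)"
    using assms(2) p_gt_2 by (simp add: of_nat_diff algebra_simps)
  then have "[int ((p - 1) * r) = int (p - r)] (mod int p)"
    by (simp only: cong_iff_dvd_diff dvd_triv_left)
  then have "[(p - 1) * r = p - r] (mod p)" by (simp only: cong_int_iff)
  then have "dirichlet_ext p \<chi> (p - r) = dirichlet_ext p \<chi> ((p - 1) * r)"
    by (rule dirichlet_ext_cong[symmetric])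
  then show ?thesis
    by (simp add: dirichlet_ext_mult[OF odd_characters_mult[OF assms(1)]] dirichlet_ext_minus_1[OF assms(1)] del: One_nat_def)
qed

text \<open>Put w = \<chi>(g). Since g^m lies in the subgroup, w^(2h) = 1 and w^h is 1 or -1. The
  value 1 is impossible because (w^h)^d = \<chi>(-1) = -1.\<close>

lemma dirichlet_ext_g_power_h:
  assumes "\<chi> \<in> odd_characters p m"
  shows "dirichlet_ext p \<chi> g ^ h = -1"
proof -
  let ?w = "dirichlet_ext p \<chi> g"
  note mc = odd_characters_mult[OF assms]
  have "[(g ^ m) ^ d = 1] (mod p)"
    unfolding power_mult[symmetric] g_power_eq_1_iff md[symmetric] by simp
  then have "int (g ^ m mod p) \<in> torsion" by (simp only: in_torsion_iff[OF not_dvd_g])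
  then have "\<chi> (int (g ^ m mod p)) = 1"
    using assms by (simp add: odd_characters_def characters_trivial_on_def index_subgroup_eq_torsion)
  then have "dirichlet_ext p \<chi> (g ^ m) = 1"
    using not_dvd_g[of m] by (simp add: dirichlet_ext_def of_nat_mod)
  then have "?w ^ m = 1" by (simp add: dirichlet_ext_power[OF mc])
  then have "(?w ^ h)\<^sup>2 = 1" by (simp add: power_mult[symmetric] mult.commute)
  then have "?w ^ h = 1 \<or> ?w ^ h = -1" by (simp add: power2_eq_1_iff)
  moreover have "(?w ^ h) ^ d = -1"
    using dirichlet_ext_cong[OF g_power_half, of \<chi>] dirichlet_ext_minus_1[OF assms]
    by (simp add: dirichlet_ext_power[OF mc] power_mult)
  ultimately show ?thesis by auto
qed

text \<open>Any exponent will do: only its class modulo p - 1 matters, by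
  \<open>power_cong_exponent\<close>.\<close>

definition dlog :: "int \<Rightarrow> nat" where
  "dlog x = (SOME i. [nat x = g ^ i] (mod p))"

lemma dlog:
  assumes "x \<in> carrier G"
  shows "[nat x = g ^ dlog x] (mod p)"
proof -
  have "\<not> p dvd nat x" using assms p_gt_2 by (auto simp: carrier_G dest: dvd_imp_le)
  then show ?thesis unfolding dlog_def by (rule someI_ex[OF log_exists])
qed

lemma character_eq_power_dlog:
  assumes "\<chi> \<in> mult_characters p" "x \<in> carrier G"
  shows "\<chi> x = dirichlet_ext p \<chi> g ^ dlog x"
  using dirichlet_ext_cong[OF dlog[OF assms(2)], of \<chi>] dirichlet_ext_carrier[OF assms(2), of \<chi>]
    dirichlet_ext_power[OF assms(1)] by simp

lemma power_cong_exponent: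
  fixes w :: complex
  assumes "w ^ h = -1" "[i = j] (mod (p - 1))"
  shows "w ^ i = w ^ j"
proof -
  have *: "w ^ k = w ^ (k mod (p - 1))" for k
  proof -
    have "w ^ (p - 1) = 1"
      by (simp only: p_eq power_mult mult.commute[of 2 "h * d"]) (simp add: assms(1) power_mult[symmetric] mult.commute)
    moreover have "w ^ k = (w ^ (p - 1)) ^ (k div (p - 1)) * w ^ (k mod (p - 1))"
      by (metis mult_div_mod_eq power_add power_mult)
    ultimately show ?thesis by simp
  qed
  show ?thesis using *[of i] *[of j] assms(2) by (simp add: cong_def)
qed

text \<open>Converse of \<open>dirichlet_ext_g_power_h\<close>. Triviality holds because x^d = 1
  forces m to divide the logarithm of x, and w^m = (w^h)^2 = 1. Oddness holds because \<chi>(-1) =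
  w^(h d) = (-1)^d with d odd.\<close>

lemma character_of_root:
  assumes w: "w ^ h = -1"
  defines "\<chi> \<equiv> restrict (\<lambda>x. w ^ dlog x) (carrier G)"
  shows "\<chi> \<in> odd_characters p m" "dirichlet_ext p \<chi> g = w"
proof -
  have w0: "w \<noteq> 0" using w h_pos by (auto simp: power_0_left)
  \<comment> \<open>The value does not depend on the exponent chosen by \<open>dlog\<close>;
    multiplicativity and the value at -1 follow from this.\<close>
  have eq: "\<chi> x = w ^ i" if "x \<in> carrier G" "[nat x = g ^ i] (mod p)" for x i
  proof -
    have "[g ^ dlog x = g ^ i] (mod p)" using dlog[OF that(1)] that(2) by (metis cong_sym cong_trans)
    then show ?thesis
      using that(1) power_cong_exponent[OF w] by (simp add: \<chi>_def g_power_cong_iff)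
  qed
  have "\<chi> (x \<otimes>\<^bsub>G\<^esub> y) = \<chi> x * \<chi> y" if xy: "x \<in> carrier G" "y \<in> carrier G" for x y
  proof -
    have "[nat (x * y mod int p) = nat x * nat y] (mod p)"
      using xy by (simp add: cong_def carrier_G nat_mod_distrib nat_mult_distrib)
    also have "[nat x * nat y = g ^ dlog x * g ^ dlog y] (mod p)"
      by (intro cong_mult dlog xy)
    finally have "[nat (x \<otimes>\<^bsub>G\<^esub> y) = g ^ (dlog x + dlog y)] (mod p)"
      by (simp add: mult_Fp_star power_add)
    then have "\<chi> (x \<otimes>\<^bsub>G\<^esub> y) = w ^ (dlog x + dlog y)"
      using xy by (intro eq) auto
    then show ?thesis using xy by (simp add: \<chi>_def power_add)
  qed
  then have mc: "\<chi> \<in> mult_characters p"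
    using w0 by (auto simp: mult_characters_def hom_def complex_star_def) (auto simp: \<chi>_def)
  have triv: "\<chi> x = 1" if "x \<in> torsion" for x
  proof -
    have x: "x \<in> carrier G" using that by (simp add: torsion_def)
    have "\<not> p dvd nat x" "nat x mod p = nat x" using x p_gt_2 by (auto simp: carrier_G dest: dvd_imp_le)
    then have "[nat x ^ d = 1] (mod p)" using in_torsion_iff[of "nat x"] that x by (simp add: carrier_G)
    moreover have "[nat x ^ d = (g ^ dlog x) ^ d] (mod p)" by (intro cong_pow dlog x)
    ultimately have "[g ^ (dlog x * d) = 1] (mod p)" by (metis cong_sym cong_trans power_mult)
    then have "m * d dvd dlog x * d" by (simp only: g_power_eq_1_iff md)
    then obtain c where "dlog x = m * c" using d_pos by (auto elim: dvdE)
    then show ?thesis using x w by (simp add: \<chi>_def power_mult power_mult[of w h 2] mult.commute[of 2 h])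
  qed
  have "\<chi> (int p - 1) = w ^ (h * d)"
    using p_gt_2 cong_sym[OF g_power_half] by (intro eq) (auto simp: carrier_G nat_diff_distrib)
  also have "\<dots> = -1" using odd_d by (simp add: power_mult w)
  finally show "\<chi> \<in> odd_characters p m"
    using mc triv neg_one_residue_ring[OF prime_p]
    by (simp add: odd_characters_def characters_trivial_on_def index_subgroup_eq_torsion)
  have ng: "\<not> p dvd g" using not_dvd_g[of 1] by simp
  then have "\<chi> (int (g mod p)) = w ^ 1"
    by (intro eq of_nat_in_G) (auto simp: cong_def)
  then show "dirichlet_ext p \<chi> g = w" using ng by (simp add: dirichlet_ext_def of_nat_mod)
qed

text \<open>Turns sums over odd characters into sums over the solutions of w^h = -1. Injectivity
  uses that characters are extensional functions determined by their value at g.\<close>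

lemma bij_odd_characters:
  "bij_betw (\<lambda>\<chi>. dirichlet_ext p \<chi> g) (odd_characters p m) {w. w ^ h = -1}"
proof (rule bij_betwI')
  fix \<chi> \<psi> assume *: "\<chi> \<in> odd_characters p m" "\<psi> \<in> odd_characters p m"
  show "dirichlet_ext p \<chi> g = dirichlet_ext p \<psi> g \<longleftrightarrow> \<chi> = \<psi>"
  proof
    assume eq: "dirichlet_ext p \<chi> g = dirichlet_ext p \<psi> g"
    show "\<chi> = \<psi>"
    proof (rule extensionalityI[of _ "carrier G"])
      show "\<chi> \<in> extensional (carrier G)" "\<psi> \<in> extensional (carrier G)"
        using *[THEN odd_characters_mult] by (auto simp: mult_characters_def)
    qed (use *[THEN odd_characters_mult] eq in \<open>simp add: character_eq_power_dlog\<close>)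
  qed simp
next
  fix w :: complex assume "w \<in> {w. w ^ h = -1}"
  then show "\<exists>\<chi>\<in>odd_characters p m. w = dirichlet_ext p \<chi> g"
    using character_of_root[of w] by (metis mem_Collect_eq)
qed (simp add: dirichlet_ext_g_power_h)

lemma card_odd_characters: "card (odd_characters p m) = h"
  using bij_betw_same_card[OF bij_odd_characters] card_nth_roots[of "-1" h] h_pos by simp

lemma norm_dirichlet_ext:
  assumes "\<chi> \<in> odd_characters p m"
  shows "norm (dirichlet_ext p \<chi> n) = (if p dvd n then 0 else 1)"
proof (cases "p dvd n")
  case False
  obtain i where i: "[n = g ^ i] (mod p)" using log_exists[OF False] by blast
  have "norm (dirichlet_ext p \<chi> g) ^ h = 1"
    using dirichlet_ext_g_power_h[OF assms] by (metis norm_minus_cancel norm_one norm_power)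
  then have "norm (dirichlet_ext p \<chi> g) = 1"
    using h_pos by (metis norm_ge_zero one_power2 power_eq_imp_eq_base power_one zero_le_one)
  then show ?thesis
    using dirichlet_ext_cong[OF i, of \<chi>] False
    by (simp add: dirichlet_ext_power[OF odd_characters_mult[OF assms]] norm_power)
qed (simp add: dirichlet_ext_def)

end

text \<open>Multiplication by z = exp(2 pi i/n) permutes the solutions and multiplies the sum by
  z^i, which differs from 1.\<close>

lemma sum_roots_power_eq_0:
  fixes c :: complex
  assumes "n > 0" "\<not> n dvd i"
  shows "(\<Sum>w | w ^ n = c. w ^ i) = 0"
proof -
  define z where "z = cis (2 * pi / real n)"
  have zn: "z ^ n = 1" using assms by (simp add: z_def DeMoivre)
  have z0: "z \<noteq> 0" by (simp add: z_def)
  have zi: "z ^ i \<noteq> 1"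
  proof
    assume "z ^ i = 1"
    then have "cis (real i * (2 * pi / real n)) = 1" by (simp add: z_def DeMoivre)
    then obtain k :: int where "real i * (2 * pi / real n) = 2 * pi * of_int k"
      by (auto simp: complex_eq_iff cos_one_2pi_int)
    then have "real i = real n * of_int k" using assms by (simp add: field_simps)
    then have "real_of_int (int i) = real_of_int (int n * k)" by simp
    then have "int i = int n * k" by (simp only: of_int_eq_iff)
    then have "int n dvd int i" by simp
    then show False using assms by (simp only: int_dvd_int_iff)
  qed
  have "(\<Sum>w | w ^ n = c. w ^ i) = (\<Sum>w | w ^ n = c. (z * w) ^ i)"
    by (rule sum.reindex_bij_witness[of _ "\<lambda>w. z * w" "\<lambda>w. w / z"])
       (use zn z0 in \<open>auto simp: power_mult_distrib power_divide\<close>)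
  also have "\<dots> = z ^ i * (\<Sum>w | w ^ n = c. w ^ i)"
    by (simp add: power_mult_distrib sum_distrib_left)
  finally have "(z ^ i - 1) * (\<Sum>w | w ^ n = c. w ^ i) = 0" by (simp add: algebra_simps)
  then show ?thesis using zi by simp
qed

section \<open>Orthogonality of the odd characters\<close>

context odd_order_residues
begin

text \<open>With s = g^i and u = g^j the summand is w^(i - j) for w = \<chi>(g). A nonzero sum over
  w^h = -1 forces h to divide i - j; hence p - 1 = 2hd divides 2d(i - j), which is the claimed
  congruence.\<close>

lemma sum_odd_characters_nonzero:
  assumes ne: "(\<Sum>\<chi>\<in>odd_characters p m. dirichlet_ext p \<chi> s * cnj (dirichlet_ext p \<chi> u)) \<noteq> 0"
    and su: "\<not> p dvd s" "\<not> p dvd u"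
  shows "[s ^ (2 * d) = u ^ (2 * d)] (mod p)"
proof -
  obtain i j where ij: "[s = g ^ i] (mod p)" "[u = g ^ j] (mod p)"
    using log_exists su by blast
  \<comment> \<open>The exponent p - 2 stands for -1: |w| = 1 and w^(p-1) = 1 give cnj w = w^(p-2),
    and all exponents stay natural numbers.\<close>
  let ?e = "i + (p - 2) * j"
  have "dirichlet_ext p \<chi> s * cnj (dirichlet_ext p \<chi> u) = dirichlet_ext p \<chi> g ^ ?e"
    if \<chi>: "\<chi> \<in> odd_characters p m" for \<chi>
  proof -
    let ?w = "dirichlet_ext p \<chi> g"
    have wh: "?w ^ h = -1" by (rule dirichlet_ext_g_power_h[OF \<chi>])
    have "norm ?w = 1" using norm_dirichlet_ext[OF \<chi>, of g] not_dvd_g[of 1] by simp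
    then have "?w * cnj ?w = 1" by (simp add: complex_norm_square[symmetric])
    moreover have "?w * ?w ^ (p - 2) = 1"
    proof -
      have "?w ^ (p - 1) = ?w ^ 0" by (rule power_cong_exponent[OF wh]) (simp add: cong_0_iff)
      moreover have "p - 1 = Suc (p - 2)" using p_gt_2 by simp
      ultimately show ?thesis by simp
    qed
    ultimately have "cnj ?w = ?w ^ (p - 2)"
      by (metis mult.left_commute mult.right_neutral)
    then show ?thesis
      using dirichlet_ext_cong[OF ij(1), of \<chi>] dirichlet_ext_cong[OF ij(2), of \<chi>]
      by (simp add: dirichlet_ext_power[OF odd_characters_mult[OF \<chi>]] power_add power_mult)
  qed
  then have "(\<Sum>\<chi>\<in>odd_characters p m. dirichlet_ext p \<chi> s * cnj (dirichlet_ext p \<chi> u))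
      = (\<Sum>\<chi>\<in>odd_characters p m. dirichlet_ext p \<chi> g ^ ?e)"
    by (rule sum.cong[OF refl])
  also have "\<dots> = (\<Sum>w | w ^ h = -1. w ^ ?e)"
    by (rule sum.reindex_bij_betw[OF bij_odd_characters])
  finally have "(\<Sum>w :: complex | w ^ h = -1. w ^ ?e) \<noteq> 0" using ne by simp
  then have "h dvd ?e" using sum_roots_power_eq_0[OF h_pos] by blast
  then have "p - 1 dvd 2 * d * ?e" unfolding p_eq by (auto elim!: dvdE)
  then have "[g ^ (2 * d * ?e) = 1] (mod p)" by (simp only: g_power_eq_1_iff)
  then have "[g ^ (2 * d * ?e) * g ^ (2 * d * j) = 1 * g ^ (2 * d * j)] (mod p)"
    by (rule cong_mult) simp
  moreover have "2 * d * ?e + 2 * d * j = 2 * d * i + (p - 1) * (2 * d * j)"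
  proof -
    have "p - 1 = Suc (p - 2)" using p_gt_2 by simp
    then show ?thesis by (simp add: algebra_simps)
  qed
  ultimately have "[g ^ (2 * d * i + (p - 1) * (2 * d * j)) = g ^ (2 * d * j)] (mod p)"
    by (metis mult_1 power_add)
  then have "[2 * d * i + (p - 1) * (2 * d * j) = 2 * d * j] (mod (p - 1))"
    by (simp only: g_power_cong_iff)
  then have "[2 * d * i = 2 * d * j] (mod (p - 1))"
    by (simp add: cong_def)
  then have "[(g ^ i) ^ (2 * d) = (g ^ j) ^ (2 * d)] (mod p)"
    by (simp only: power_mult[symmetric] g_power_cong_iff mult.commute)
  moreover have "[s ^ (2 * d) = (g ^ i) ^ (2 * d)] (mod p)" "[u ^ (2 * d) = (g ^ j) ^ (2 * d)] (mod p)"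
    using ij by (auto intro: cong_pow)
  ultimately show ?thesis by (metis cong_sym cong_trans)
qed

end

section \<open>The value of the L-series at 1\<close>

text \<open>Since the values of an odd character over a period sum to zero, \<open>1 / ((j + 1) p)\<close> can be
  subtracted from every coefficient of the \<open>j\<close>-th block, which makes the series over \<open>j\<close> converge absolutely.\<close>

definition L_coef_term :: "nat \<Rightarrow> nat \<Rightarrow> nat \<Rightarrow> real" where
  "L_coef_term p r j = 1 / real (j * p + r) - 1 / real (Suc j * p)"

text \<open>For 0 < r this is -(psi(r/p) + gamma)/p, with psi the digamma function and gamma Euler's
  constant.\<close>

definition L_coef :: "nat \<Rightarrow> nat \<Rightarrow> real" where
  "L_coef p r = suminf (L_coef_term p r)"

text \<open>The term at 0 equals 1/r - 1/p and is kept exact. Later terms are compared, through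
  1/(jp + r) <= 1/(jp), with a telescoping series of sum 1/p; this places \<open>L_coef p r\<close>
  between 1/r - 1/p and 1/r.\<close>

lemma L_coef_term_Suc_bounds:
  assumes "0 < r" "r \<le> p"
  shows "0 \<le> L_coef_term p r j" "L_coef_term p r (Suc j) \<le> 1 / real p * (1 / real (Suc j) - 1 / real (Suc (Suc j)))"
proof -
  have "j * p + r \<le> Suc j * p" using assms by simp
  then show "0 \<le> L_coef_term p r j"
    unfolding L_coef_term_def using assms by (auto intro!: divide_left_mono simp flip: of_nat_mult of_nat_add)
  have "1 / real (Suc j * p + r) \<le> 1 / real (Suc j * p)"
    using assms by (intro divide_left_mono) (auto simp flip: of_nat_mult)
  moreover have e: "1 / real p * (1 / real a) = 1 / real (a * p)" for a by simp
  ultimately show "L_coef_term p r (Suc j) \<le> 1 / real p * (1 / real (Suc j) - 1 / real (Suc (Suc j)))"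
    unfolding right_diff_distrib e L_coef_term_def by linarith
qed

lemma telescope_inverse_sums: "(\<lambda>j. c * (1 / real (Suc j) - 1 / real (Suc (Suc j)))) sums c"
proof -
  have "(\<lambda>j. 1 / real (Suc j) - 1 / real (Suc (Suc j))) sums (1 / real (Suc 0) - 0)"
    by (rule telescope_sums'[OF LIMSEQ_Suc[OF lim_1_over_n]])
  from sums_mult[OF this, of c] show ?thesis by simp
qed

lemma
  assumes "0 < r" "r \<le> p"
  shows summable_L_coef_term: "summable (L_coef_term p r)"
    and L_coef_lower: "1 / real r - 1 / real p \<le> L_coef p r"
    and L_coef_upper: "L_coef p r \<le> 1 / real r"
proof -
  note bounds = L_coef_term_Suc_bounds[OF assms]
  note tele = telescope_inverse_sums[of "1 / real p"]
  have summ: "summable (\<lambda>j. L_coef_term p r (Suc j))"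
    by (rule summable_comparison_test'[OF sums_summable[OF tele], where N = 0])
       (use bounds in auto)
  then show s: "summable (L_coef_term p r)" by (simp only: summable_Suc_iff)
  have split: "L_coef p r = (1 / real r - 1 / real p) + (\<Sum>j. L_coef_term p r (Suc j))"
    using suminf_split_head[OF s] by (simp add: L_coef_def L_coef_term_def[of p r 0])
  have "0 \<le> (\<Sum>j. L_coef_term p r (Suc j))" using bounds(1) by (intro suminf_nonneg summ)
  then show "1 / real r - 1 / real p \<le> L_coef p r" by (simp add: split)
  have "(\<Sum>j. L_coef_term p r (Suc j)) \<le> 1 / real p"
    using suminf_le[OF bounds(2) summ sums_summable[OF tele]] sums_unique[OF tele] by simp
  then show "L_coef p r \<le> 1 / real r" by (simp add: split)
qed

text \<open>A partial sum differs from a sum of complete blocks by fewer than p terms, each tending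
  to zero. This recovers the ordered sum of a conditionally convergent series from its block
  sums.\<close>

lemma sums_of_block_sums:
  fixes f :: "nat \<Rightarrow> 'a :: real_normed_vector"
  assumes p: "p > 0" and f: "\<And>n. norm (f n) \<le> 1 / real (Suc n)"
    and S: "(\<lambda>j. \<Sum>n = j * p..<j * p + p. f n) sums S"
  shows "f sums S"
proof -
  have split: "(\<Sum>n<N. f n) = (\<Sum>j<N div p. \<Sum>n = j * p..<j * p + p. f n) + (\<Sum>n = (N div p) * p..<N. f n)" for N
  proof -
    have "(N div p) * p \<le> N" by simp
    then have "(\<Sum>n<N. f n) = (\<Sum>n<(N div p) * p. f n) + (\<Sum>n = (N div p) * p..<N. f n)"
      by (simp only: lessThan_atLeast0) (subst sum.atLeastLessThan_concat, auto)
    then show ?thesis by (simp add: sum.nat_group)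
  qed
  have div: "filterlim (\<lambda>N. N div p) at_top at_top"
    by (rule filterlim_at_top_div_const_nat[OF p])
  have "(\<lambda>N. \<Sum>n = (N div p) * p..<N. f n) \<longlonglongrightarrow> 0"
  proof (rule tendsto_0_le[where K = 1])
    show "(\<lambda>N. real p * (1 / real (Suc (N div p)))) \<longlonglongrightarrow> 0"
      using tendsto_mult_right_zero[OF filterlim_compose[OF LIMSEQ_Suc[OF lim_1_over_n] div], of "real p"]
      by simp
    show "\<forall>\<^sub>F N in sequentially. norm (\<Sum>n = (N div p) * p..<N. f n) \<le> norm (real p * (1 / real (Suc (N div p)))) * 1"
    proof (rule always_eventually, rule allI)
      fix N
      have "norm (\<Sum>n = (N div p) * p..<N. f n) \<le> (\<Sum>n = (N div p) * p..<N. 1 / real (Suc (N div p)))"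
      proof (rule sum_norm_le)
        fix n assume n: "n \<in> {(N div p) * p..<N}"
        \<comment> \<open>The crude bound n >= N div p suffices, since p is fixed while N
          grows.\<close>
        have "N div p * 1 \<le> N div p * p" using p by (intro mult_le_mono2) simp
        moreover have "N div p * p \<le> n" using n by simp
        ultimately have "N div p \<le> n" by linarith
        then have "1 / real (Suc n) \<le> 1 / real (Suc (N div p))" by (intro divide_left_mono) auto
        then show "norm (f n) \<le> 1 / real (Suc (N div p))" using f[of n] by linarith
      qed
      also have "\<dots> = real (N - (N div p) * p) * (1 / real (Suc (N div p)))" by simp
      also have "\<dots> \<le> real p * (1 / real (Suc (N div p)))"
        using p by (intro mult_right_mono) (auto simp: minus_div_mult_eq_mod less_imp_le)
      finally show "norm (\<Sum>n = (N div p) * p..<N. f n) \<le> norm (real p * (1 / real (Suc (N div p)))) * 1"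
        by simp
    qed
  qed
  moreover have "(\<lambda>N. \<Sum>j<N div p. \<Sum>n = j * p..<j * p + p. f n) \<longlonglongrightarrow> S"
    using filterlim_compose[OF S[unfolded sums_def] div] by simp
  ultimately show ?thesis
    unfolding sums_def split using tendsto_add[of _ S _ _ 0] by fastforce
qed

lemma periodic_L_series:
  fixes X :: "nat \<Rightarrow> complex"
  assumes p: "p > 0" and per: "\<And>n. X (n mod p) = X n" and X0: "X 0 = 0"
    and bd: "\<And>n. norm (X n) \<le> 1" and zero: "(\<Sum>r = 1..p - 1. X r) = 0"
  shows "(\<Sum>n. X (Suc n) / of_nat (Suc n)) = (\<Sum>r = 1..p - 1. of_real (L_coef p r) * X r)"
proof -
  have "(\<lambda>n. X (Suc n) / of_nat (Suc n)) sums (\<Sum>r = 1..p - 1. of_real (L_coef p r) * X r)"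
  proof (rule sums_of_block_sums[OF p])
    show "norm (X (Suc n) / of_nat (Suc n)) \<le> 1 / real (Suc n)" for n
      using bd[of "Suc n"] by (simp only: norm_divide norm_of_nat divide_right_mono of_nat_0_le_iff)
    have block: "(\<Sum>n = j * p..<j * p + p. X (Suc n) / of_nat (Suc n)) = (\<Sum>r = 1..p - 1. of_real (L_coef_term p r j) * X r)" for j
    proof -
      \<comment> \<open>The n-th term belongs to \<open>Suc n\<close>, so a block covers the
        residues 1 to p; the last one contributes X p = X 0 = 0.\<close>
      have "(\<Sum>n = j * p..<j * p + p. X (Suc n) / of_nat (Suc n)) = (\<Sum>r = 1..p. X r / of_nat (j * p + r))"
      proof (rule sum.reindex_bij_witness[of _ "\<lambda>r. j * p + r - 1" "\<lambda>n. Suc n - j * p"])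
        fix n assume n: "n \<in> {j * p..<j * p + p}"
        then have "Suc n = j * p + (Suc n - j * p)" by auto
        then have "Suc n mod p = (Suc n - j * p) mod p"
          by (metis mod_mult_self3)
        then have "X (Suc n - j * p) = X (Suc n)" by (metis per)
        then show "X (Suc n - j * p) / of_nat (j * p + (Suc n - j * p)) = X (Suc n) / of_nat (Suc n)"
          using \<open>Suc n = j * p + (Suc n - j * p)\<close> by simp
      qed auto
      also have "\<dots> = (\<Sum>r = 1..p - 1. X r / of_nat (j * p + r)) + X p / of_nat (j * p + p)"
        using p by (cases p) (auto simp: sum.cl_ivl_Suc)
      also have "X p = 0" using per[of p] X0 by simp
      \<comment> \<open>A multiple of the vanishing period sum is subtracted, which turns 1/(jp + r)
        into the summable \<open>L_coef_term\<close>.\<close>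
      also have "(\<Sum>r = 1..p - 1. X r / of_nat (j * p + r)) + 0 / of_nat (j * p + p)
          = (\<Sum>r = 1..p - 1. X r / of_nat (j * p + r)) - (\<Sum>r = 1..p - 1. X r) / of_nat (Suc j * p)"
        using zero by simp
      also have "\<dots> = (\<Sum>r = 1..p - 1. of_real (L_coef_term p r j) * X r)"
        unfolding sum_divide_distrib sum_subtractf[symmetric]
        by (intro sum.cong refl) (simp add: L_coef_term_def algebra_simps)
      finally show ?thesis .
    qed
    have "L_coef_term p r sums L_coef p r" if "r \<in> {1..p - 1}" for r
      unfolding L_coef_def using that by (intro summable_sums summable_L_coef_term) auto
    then show "(\<lambda>j. \<Sum>n = j * p..<j * p + p. X (Suc n) / of_nat (Suc n)) sums
        (\<Sum>r = 1..p - 1. of_real (L_coef p r) * X r)"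
      unfolding block by (intro sums_sum sums_mult2 sums_of_real)
  qed
  then show ?thesis by (rule sums_unique[symmetric])
qed

section \<open>Multiplicative convolution modulo a prime\<close>

definition mconv :: "nat \<Rightarrow> (nat \<Rightarrow> real) \<Rightarrow> (nat \<Rightarrow> real) \<Rightarrow> nat \<Rightarrow> real" where
  "mconv p f g s = (\<Sum>r = 1..p - 1. \<Sum>u = 1..p - 1. if r * u mod p = s then f r * g u else 0)"

fun L_power_coef :: "nat \<Rightarrow> nat \<Rightarrow> nat \<Rightarrow> real" where
  "L_power_coef p 0 = (\<lambda>s. if s = 1 then 1 else 0)"
| "L_power_coef p (Suc k) = mconv p (L_coef p) (L_power_coef p k)"

lemma residue_not_dvd: "r \<in> {1..p - 1} \<Longrightarrow> \<not> p dvd (r :: nat)"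
  by (auto dest!: dvd_imp_le)

lemma residue_mult_mem:
  fixes p r u :: nat
  assumes "prime p" "r \<in> {1..p - 1}" "u \<in> {1..p - 1}"
  shows "r * u mod p \<in> {1..p - 1}"
proof -
  have "\<not> p dvd r" "\<not> p dvd u" using residue_not_dvd[OF assms(2)] residue_not_dvd[OF assms(3)] by blast+
  then have "\<not> p dvd r * u" using assms(1) by (simp add: prime_dvd_mult_iff)
  then have "r * u mod p \<noteq> 0" by (simp add: dvd_eq_mod_eq_0)
  moreover have "r * u mod p < p" using assms(1) by (simp add: prime_gt_0_nat)
  ultimately show ?thesis by auto
qed

lemma sum_mconv_mult:
  fixes X :: "nat \<Rightarrow> complex"
  assumes "prime p" and per: "\<And>n. X (n mod p) = X n" and mult: "\<And>a b. X (a * b) = X a * X b"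
  shows "(\<Sum>s = 1..p - 1. of_real (mconv p f g s) * X s)
    = (\<Sum>r = 1..p - 1. of_real (f r) * X r) * (\<Sum>u = 1..p - 1. of_real (g u) * X u)"
proof -
  let ?R = "{1..p - 1}"
  have "(\<Sum>s\<in>?R. of_real (mconv p f g s) * X s)
      = (\<Sum>s\<in>?R. \<Sum>r\<in>?R. \<Sum>u\<in>?R. if s = r * u mod p then of_real (f r * g u) * X s else 0)"
    unfolding mconv_def of_real_sum sum_distrib_right by (intro sum.cong refl) auto
  also have "\<dots> = (\<Sum>r\<in>?R. \<Sum>u\<in>?R. \<Sum>s\<in>?R. if s = r * u mod p then of_real (f r * g u) * X s else 0)"
    by (subst sum.swap, rule sum.cong[OF refl], subst sum.swap, rule refl)
  also have "\<dots> = (\<Sum>r\<in>?R. \<Sum>u\<in>?R. of_real (f r * g u) * X (r * u mod p))"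
    by (intro sum.cong refl) (use residue_mult_mem[OF assms(1)] in \<open>simp add: sum.delta\<close>)
  also have "\<dots> = (\<Sum>r\<in>?R. of_real (f r) * X r) * (\<Sum>u\<in>?R. of_real (g u) * X u)"
    by (simp add: per mult sum_product mult_ac)
  finally show ?thesis .
qed

lemma L_power_expansion:
  fixes X :: "nat \<Rightarrow> complex"
  assumes "prime p" "\<And>n. X (n mod p) = X n" "\<And>a b. X (a * b) = X a * X b" "X 1 = 1"
  shows "(\<Sum>s = 1..p - 1. of_real (L_power_coef p k s) * X s)
    = (\<Sum>r = 1..p - 1. of_real (L_coef p r) * X r) ^ k"
proof (induction k)
  case 0
  have "(\<Sum>s = 1..p - 1. of_real (L_power_coef p 0 s) * X s) = (\<Sum>s\<in>{1..p - 1}. if s = 1 then 1 else 0)"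
    by (intro sum.cong) (use assms(4) in auto)
  also have "\<dots> = 1" using prime_gt_1_nat[OF assms(1)] by (subst sum.delta) auto
  finally show ?case by simp
next
  case (Suc k)
  then show ?case using sum_mconv_mult[OF assms(1-3)] by simp
qed

lemma residue_mult_unique:
  fixes p r u v :: nat
  assumes "prime p" "r \<in> {1..p - 1}" "u \<in> {1..p - 1}" "v \<in> {1..p - 1}" "r * u mod p = r * v mod p"
  shows "u = v"
proof -
  have "\<not> p dvd r" using assms(2) by (rule residue_not_dvd)
  then have "coprime r p" using assms(1) by (metis coprime_commute prime_imp_coprime)
  then have "[u = v] (mod p)" using assms(5) by (simp add: cong_def[symmetric] cong_mult_lcancel_nat)
  moreover have "u < p" "v < p" using assms(3,4) by auto
  ultimately show ?thesis by (simp add: cong_def)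
qed

text \<open>Multiplication by r is injective on nonzero residues, so at most one u
  contributes.\<close>

lemma sum_residue_fiber_le:
  fixes B :: real and p r s :: nat
  assumes "prime p" "r \<in> {1..p - 1}" "\<And>u. u \<in> {1..p - 1} \<Longrightarrow> f u \<le> B" "B \<ge> 0"
  shows "(\<Sum>u = 1..p - 1. if r * u mod p = s then f u else 0) \<le> B"
proof (cases "\<exists>v\<in>{1..p - 1}. r * v mod p = s")
  case True
  then obtain v where v: "v \<in> {1..p - 1}" "r * v mod p = s" by blast
  have "(\<Sum>u = 1..p - 1. if r * u mod p = s then f u else 0) = (\<Sum>u\<in>{1..p - 1}. if u = v then f u else 0)"
  proof (intro sum.cong refl)
    fix u assume "u \<in> {1..p - 1}"
    then have "r * u mod p = s \<longleftrightarrow> u = v"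
      using residue_mult_unique[OF assms(1,2) _ v(1), of u] v(2) by auto
    then show "(if r * u mod p = s then f u else 0) = (if u = v then f u else 0)" by simp
  qed
  also have "\<dots> = f v" using v(1) by (subst sum.delta) auto
  finally show ?thesis using assms(3)[OF v(1)] by simp
next
  case False
  then have "(\<Sum>u = 1..p - 1. if r * u mod p = s then f u else 0) = 0"
    by (intro sum.neutral) auto
  then show ?thesis using assms(4) by simp
qed

text \<open>The l^1 times l^infinity bound for convolutions. It carries a pointwise error through
  one convolution at the cost of an l^1 norm, which is only a power of the logarithm in the
  applications.\<close>

lemma abs_mconv_le:
  assumes "prime p" "\<And>u. u \<in> {1..p - 1} \<Longrightarrow> \<bar>g u\<bar> \<le> B" "B \<ge> 0"
  shows "\<bar>mconv p f g s\<bar> \<le> (\<Sum>r = 1..p - 1. \<bar>f r\<bar>) * B"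
proof -
  have "\<bar>mconv p f g s\<bar> \<le> (\<Sum>r = 1..p - 1. \<Sum>u = 1..p - 1. if r * u mod p = s then \<bar>f r\<bar> * \<bar>g u\<bar> else 0)"
    unfolding mconv_def
    by (rule order.trans[OF sum_abs], rule sum_mono, rule order.trans[OF sum_abs], rule sum_mono)
       (simp add: abs_mult)
  also have "\<dots> = (\<Sum>r = 1..p - 1. \<bar>f r\<bar> * (\<Sum>u = 1..p - 1. if r * u mod p = s then \<bar>g u\<bar> else 0))"
    by (simp add: sum_distrib_left if_distrib[of "\<lambda>x. _ * x"] cong: if_cong)
  also have "\<dots> \<le> (\<Sum>r = 1..p - 1. \<bar>f r\<bar> * B)"
    by (intro sum_mono mult_left_mono sum_residue_fiber_le assms) auto
  finally show ?thesis by (simp add: sum_distrib_right)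
qed

lemma mconv_commute: "mconv p f g s = mconv p g f s"
  unfolding mconv_def by (subst sum.swap, intro sum.cong refl) (simp add: mult.commute)

text \<open>The pairs with r * u = s, without reduction modulo p, form an ordinary Dirichlet
  convolution, since all divisors of s lie below p.\<close>

lemma mconv_tau_main:
  assumes "p > 0" "s \<in> {1..p - 1}"
  shows "(\<Sum>r = 1..p - 1. \<Sum>u = 1..p - 1. if r * u = s then 1 / real r * (real (tau k u) / real u) else 0)
    = real (tau (Suc k) s) / real s"
proof -
  let ?R = "{1..p - 1}"
  have s: "s > 0" "s < p" using assms by auto
  have "real (tau (Suc k) s) / real s = (\<Sum>r | r dvd s. 1 / real r * (real (tau k (s div r)) / real (s div r)))"
  proof -
    have "real (tau (Suc k) s) / real s = (\<Sum>r | r dvd s. real (tau k (s div r)) / real s)"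
      using s by (simp add: tau_Suc sum_divide_distrib)
    also have "\<dots> = (\<Sum>r | r dvd s. 1 / real r * (real (tau k (s div r)) / real (s div r)))"
      by (intro sum.cong refl) (use s in \<open>auto simp: real_of_nat_div\<close>)
    finally show ?thesis .
  qed
  also have "\<dots> = (\<Sum>r\<in>{r. r dvd s}. \<Sum>u\<in>?R. if r * u = s then 1 / real r * (real (tau k u) / real u) else 0)"
  proof (intro sum.cong refl)
    fix r assume "r \<in> {r. r dvd s}"
    then obtain e where e: "s = r * e" by (auto elim: dvdE)
    have "e \<noteq> 0" using s e by (intro notI) simp
    moreover have "e \<le> s" using s e by (intro dvd_imp_le) auto
    ultimately have "e \<in> ?R" using s(2) by simp
    have "r > 0" using s e by (auto intro!: Nat.gr0I)
    have "(\<Sum>u\<in>?R. if r * u = s then 1 / real r * (real (tau k u) / real u) else 0)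
        = (\<Sum>u\<in>?R. if u = e then 1 / real r * (real (tau k u) / real u) else 0)"
      using e \<open>r > 0\<close> by (intro sum.cong refl) auto
    also have "\<dots> = 1 / real r * (real (tau k (s div r)) / real (s div r))"
      using \<open>e \<in> ?R\<close> e \<open>r > 0\<close> by (subst sum.delta) auto
    finally show "1 / real r * (real (tau k (s div r)) / real (s div r))
        = (\<Sum>u\<in>?R. if r * u = s then 1 / real r * (real (tau k u) / real u) else 0)" by simp
  qed
  also have "\<dots> = (\<Sum>r\<in>?R. \<Sum>u\<in>?R. if r * u = s then 1 / real r * (real (tau k u) / real u) else 0)"
  proof (rule sum.mono_neutral_left)
    show "{r. r dvd s} \<subseteq> ?R"
    proof
      fix r assume "r \<in> {r. r dvd s}"
      then have "r \<le> s" "r \<noteq> 0" using s(1) by (auto dest: dvd_imp_le)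
      then show "r \<in> ?R" using s(2) by simp
    qed
    show "\<forall>r\<in>?R - {r. r dvd s}. (\<Sum>u\<in>?R. if r * u = s then 1 / real r * (real (tau k u) / real u) else 0) = 0"
      by (auto intro!: sum.neutral split: if_splits)
  qed simp
  finally show ?thesis by simp
qed

lemma card_residue_pairs_le:
  fixes p n :: nat
  assumes "n > 0"
  shows "card {(r, u). r \<in> {1..p - 1} \<and> u \<in> {1..p - 1} \<and> r * u = n} \<le> card {d. d dvd n}"
proof (rule card_inj_on_le[where f = fst])
  show "inj_on fst {(r, u). r \<in> {1..p - 1} \<and> u \<in> {1..p - 1} \<and> r * u = n}"
    by (rule inj_onI) auto
qed (use assms in auto)

text \<open>Group the pairs by j = r u div p, which lies between 1 and p - 1. Then r u = jp + s is a
  fixed number at most p^2, so the divisor bound allows at most K p^(2 \<epsilon>) pairs, each of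
  weight at most 1/(jp).\<close>

lemma sum_wrapped_products_le:
  assumes p: "prime p" and s: "s \<in> {1..p - 1}" and \<epsilon>: "\<epsilon> > 0"
    and K: "K \<ge> 1" "\<And>n. n > 0 \<Longrightarrow> real (card {d. d dvd n}) \<le> K * real n powr \<epsilon>"
  defines "P \<equiv> {(r, u). r \<in> {1..p - 1} \<and> u \<in> {1..p - 1} \<and> r * u mod p = s \<and> p \<le> r * u}"
  shows "(\<Sum>(r, u)\<in>P. 1 / real (r * u)) \<le> K * real p powr (2 * \<epsilon> - 1) * harm_sum (p - 1)"
proof -
  have p0: "p > 0" using p by (simp add: prime_gt_0_nat)
  have fin: "finite P"
    by (rule finite_subset[of _ "{1..p - 1} \<times> {1..p - 1}"]) (auto simp: P_def)
  have img: "(\<lambda>(r, u). r * u div p) ` P \<subseteq> {1..p - 1}"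
  proof
    fix j assume "j \<in> (\<lambda>(r, u). r * u div p) ` P"
    then obtain r u where *: "j = r * u div p" "r \<le> p - 1" "u \<le> p - 1" "p \<le> r * u"
      by (auto simp: P_def)
    have "r * u \<le> (p - 1) * (p - 1)" using * by (intro mult_le_mono)
    also have "\<dots> < p * p" using p0 by (intro mult_strict_mono) auto
    finally have "j < p" using * p0 by (simp add: less_mult_imp_div_less)
    moreover have "p div p \<le> j" unfolding *(1) by (rule div_le_mono[OF *(4)])
    ultimately show "j \<in> {1..p - 1}" using p0 by simp
  qed
  have "(\<Sum>(r, u)\<in>P. 1 / real (r * u))
      = (\<Sum>j = 1..p - 1. \<Sum>(r, u)\<in>{x \<in> P. (\<lambda>(r, u). r * u div p) x = j}. 1 / real (r * u))"
    by (rule sum.group[OF fin _ img, symmetric]) simp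
  also have "\<dots> \<le> (\<Sum>j = 1..p - 1. K * real p powr (2 * \<epsilon>) * (1 / real (j * p)))"
  proof (rule sum_mono)
    fix j assume j: "j \<in> {1..p - 1}"
    let ?n = "j * p + s"
    let ?Q = "{x \<in> P. (\<lambda>(r, u). r * u div p) x = j}"
    have n0: "?n > 0" using s by auto
    have Q: "?Q \<subseteq> {(r, u). r \<in> {1..p - 1} \<and> u \<in> {1..p - 1} \<and> r * u = ?n}"
    proof
      fix x assume "x \<in> ?Q"
      then obtain r u where *: "x = (r, u)" "r \<in> {1..p - 1}" "u \<in> {1..p - 1}"
          "r * u mod p = s" "r * u div p = j"
        by (auto simp: P_def)
      then have "r * u = ?n" by (metis div_mult_mod_eq)
      then show "x \<in> {(r, u). r \<in> {1..p - 1} \<and> u \<in> {1..p - 1} \<and> r * u = ?n}"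
        using * by simp
    qed
    have "card ?Q \<le> card {(r, u). r \<in> {1..p - 1} \<and> u \<in> {1..p - 1} \<and> r * u = ?n}"
      by (rule card_mono[OF finite_subset[of _ "{1..p - 1} \<times> {1..p - 1}"] Q]) auto
    also have "\<dots> \<le> card {d. d dvd ?n}" by (rule card_residue_pairs_le[OF n0])
    finally have "real (card ?Q) \<le> real (card {d. d dvd ?n})" by simp
    also have "\<dots> \<le> K * real ?n powr \<epsilon>" by (rule K(2)[OF n0])
    also have "\<dots> \<le> K * (real p powr 2) powr \<epsilon>"
    proof (intro mult_left_mono powr_mono2)
      have "?n \<le> (p - 1) * p + p" using j s p0 by (intro add_mono mult_le_mono) auto
      also have "\<dots> = p * p" using p0 by (cases p) auto
      finally have "real ?n \<le> real (p * p)" by (simp only: of_nat_le_iff)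
      then show "real ?n \<le> real p powr 2" using p0 by (simp add: powr_numeral power2_eq_square)
    qed (use \<epsilon> K in auto)
    also have "\<dots> = K * real p powr (2 * \<epsilon>)" by (simp only: powr_powr)
    finally have card: "real (card ?Q) \<le> K * real p powr (2 * \<epsilon>)" .
    have "(\<Sum>(r, u)\<in>?Q. 1 / real (r * u)) \<le> (\<Sum>x\<in>?Q. 1 / real (j * p))"
    proof (rule sum_mono)
      fix x assume "x \<in> ?Q"
      then obtain r u where *: "x = (r, u)" "r * u = ?n" using Q by auto
      have "1 / real ?n \<le> 1 / real (j * p)"
        using j p0 by (intro divide_left_mono) (auto simp flip: of_nat_mult of_nat_add)
      then show "(case x of (r, u) \<Rightarrow> 1 / real (r * u)) \<le> 1 / real (j * p)"
        unfolding *(1) prod.case *(2) .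
    qed
    also have "\<dots> = real (card ?Q) * (1 / real (j * p))" by simp
    also have "\<dots> \<le> K * real p powr (2 * \<epsilon>) * (1 / real (j * p))"
      by (rule mult_right_mono[OF card]) simp
    finally show "(\<Sum>(r, u)\<in>?Q. 1 / real (r * u)) \<le> K * real p powr (2 * \<epsilon>) * (1 / real (j * p))" .
  qed
  also have "\<dots> = K * (real p powr (2 * \<epsilon>) / real p) * harm_sum (p - 1)"
    unfolding harm_sum_def sum_distrib_left by (intro sum.cong refl) simp
  also have "real p powr (2 * \<epsilon>) / real p = real p powr (2 * \<epsilon> - 1)"
    using p0 by (simp add: powr_diff)
  finally show ?thesis .
qed

text \<open>A product of residues congruent to s either equals s, which gives the main term, or is
  at least p. On the latter pairs tau_k(u) <= T p^\<epsilon>, which raises the exponent 2 \<epsilon>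
  - 1 to 3 \<epsilon> - 1.\<close>

lemma mconv_tau_error:
  assumes p: "prime p" and s: "s \<in> {1..p - 1}" and \<epsilon>: "\<epsilon> > 0"
    and K: "K \<ge> 1" "\<And>n. n > 0 \<Longrightarrow> real (card {d. d dvd n}) \<le> K * real n powr \<epsilon>"
    and T: "T \<ge> 1" "\<And>n. n > 0 \<Longrightarrow> real (tau k n) \<le> T * real n powr \<epsilon>"
  shows "\<bar>mconv p (\<lambda>r. 1 / real r) (\<lambda>u. real (tau k u) / real u) s - real (tau (Suc k) s) / real s\<bar>
    \<le> T * K * real p powr (3 * \<epsilon> - 1) * harm_sum (p - 1)"
proof -
  let ?R = "{1..p - 1}"
  let ?w = "\<lambda>r u. 1 / real r * (real (tau k u) / real u)"
  define P where "P = {(r, u). r \<in> ?R \<and> u \<in> ?R \<and> r * u mod p = s \<and> p \<le> r * u}"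
  have p0: "p > 0" using p by (simp add: prime_gt_0_nat)
  have fin: "finite P"
    by (rule finite_subset[of _ "?R \<times> ?R"]) (auto simp: P_def)
  have "mconv p (\<lambda>r. 1 / real r) (\<lambda>u. real (tau k u) / real u) s
      = (\<Sum>r\<in>?R. \<Sum>u\<in>?R. (if r * u = s then ?w r u else 0) + (if (r, u) \<in> P then ?w r u else 0))"
    unfolding mconv_def
  proof (intro sum.cong refl)
    fix r u assume ru: "r \<in> ?R" "u \<in> ?R"
    have "s < p" using s p0 by auto
    show "(if r * u mod p = s then ?w r u else 0)
        = (if r * u = s then ?w r u else 0) + (if (r, u) \<in> P then ?w r u else 0)"
    proof (cases "p \<le> r * u")
      case True
      then have "r * u \<noteq> s" using \<open>s < p\<close> by simp
      then show ?thesis using True ru by (simp add: P_def)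
    next
      case False
      then have "r * u mod p = r * u" by simp
      then show ?thesis using False by (simp add: P_def)
    qed
  qed
  also have "\<dots> = real (tau (Suc k) s) / real s + (\<Sum>r\<in>?R. \<Sum>u\<in>?R. if (r, u) \<in> P then ?w r u else 0)"
    by (simp only: sum.distrib mconv_tau_main[OF p0 s])
  also have "(\<Sum>r\<in>?R. \<Sum>u\<in>?R. if (r, u) \<in> P then ?w r u else 0) = (\<Sum>x\<in>?R \<times> ?R. if x \<in> P then ?w (fst x) (snd x) else 0)"
    by (subst sum.cartesian_product) (simp add: case_prod_beta)
  also have "\<dots> = (\<Sum>x\<in>P. ?w (fst x) (snd x))"
    by (rule sum.mono_neutral_cong_right) (auto simp: P_def)
  finally have eq: "mconv p (\<lambda>r. 1 / real r) (\<lambda>u. real (tau k u) / real u) s - real (tau (Suc k) s) / real s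
      = (\<Sum>x\<in>P. ?w (fst x) (snd x))" by simp
  have "(\<Sum>x\<in>P. ?w (fst x) (snd x)) \<le> (\<Sum>x\<in>P. T * real p powr \<epsilon> * (case x of (r, u) \<Rightarrow> 1 / real (r * u)))"
  proof (rule sum_mono)
    fix x assume "x \<in> P"
    then obtain r u where x: "x = (r, u)" "r \<in> ?R" "u \<in> ?R" by (auto simp: P_def)
    have "real (tau k u) \<le> T * real u powr \<epsilon>" using T(2)[of u] x(3) by simp
    also have "\<dots> \<le> T * real p powr \<epsilon>"
      using T(1) \<epsilon> x(3) by (intro mult_left_mono powr_mono2) auto
    finally have "real (tau k u) / real (r * u) \<le> T * real p powr \<epsilon> / real (r * u)"
      by (rule divide_right_mono) simp
    then show "?w (fst x) (snd x) \<le> T * real p powr \<epsilon> * (case x of (r, u) \<Rightarrow> 1 / real (r * u))"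
      by (simp add: x(1))
  qed
  also have "\<dots> = T * real p powr \<epsilon> * (\<Sum>(r, u)\<in>P. 1 / real (r * u))"
    by (simp only: sum_distrib_left)
  also have "\<dots> \<le> T * real p powr \<epsilon> * (K * real p powr (2 * \<epsilon> - 1) * harm_sum (p - 1))"
    unfolding P_def using T by (intro mult_left_mono sum_wrapped_products_le[OF p s \<epsilon> K]) auto
  also have "\<dots> = T * K * (real p powr \<epsilon> * real p powr (2 * \<epsilon> - 1)) * harm_sum (p - 1)"
    by (simp only: mult_ac)
  also have "real p powr \<epsilon> * real p powr (2 * \<epsilon> - 1) = real p powr (3 * \<epsilon> - 1)"
    by (simp add: powr_add[symmetric])
  finally show ?thesis unfolding eq by (subst abs_of_nonneg) (auto intro!: sum_nonneg)
qed

lemma mconv_add_left: "mconv p (\<lambda>r. f r + f' r) g s = mconv p f g s + mconv p f' g s"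
  unfolding mconv_def sum.distrib[symmetric]
  by (intro sum.cong refl) (simp add: algebra_simps)

lemma mconv_add_right: "mconv p f (\<lambda>r. g r + g' r) s = mconv p f g s + mconv p f g' s"
  unfolding mconv_def sum.distrib[symmetric]
  by (intro sum.cong refl) (simp add: algebra_simps)

lemma harm_sum_ge_1: "N \<ge> 1 \<Longrightarrow> harm_sum N \<ge> 1"
  unfolding harm_sum_def
  using member_le_sum[of 1 "{1..N}" "\<lambda>n. 1 / real n"] by auto

text \<open>One convolution step has three errors: the inherited one convolved with
  \<open>L_coef\<close>, the deviation of \<open>L_coef\<close> from 1/r convolved with tau_k(u)/u,
  and the wrapped products. They contribute C, 1 and T * K to the new constant.\<close>

lemma L_power_coef_error:
  "\<exists>C\<ge>0. \<forall>p. prime p \<longrightarrow> (\<forall>s\<in>{1..p - 1}.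
     \<bar>L_power_coef p k s - real (tau k s) / real s\<bar> \<le> C * harm_sum (p - 1) ^ k * real p powr (-7/8))"
proof (induction k)
  case 0
  show ?case by (rule exI[of _ 0]) (auto simp: tau_0)
next
  case (Suc k)
  then obtain C where C: "C \<ge> 0" "\<And>p s. prime p \<Longrightarrow> s \<in> {1..p - 1} \<Longrightarrow>
      \<bar>L_power_coef p k s - real (tau k s) / real s\<bar> \<le> C * harm_sum (p - 1) ^ k * real p powr (-7/8)"
    by blast
  \<comment> \<open>3/24 - 1 = -7/8. An exponent of -3/4 would already do, since p times the square
    of the error has to be at most p^(-1/2) up to logarithms.\<close>
  obtain K where K: "K \<ge> 1" "\<And>n. n > 0 \<Longrightarrow> real (card {d. d dvd n}) \<le> K * real n powr (1/24)"
    using divisor_bound[of "1/24"] by auto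
  obtain T where T: "T \<ge> 1" "\<And>n. n > 0 \<Longrightarrow> real (tau k n) \<le> T * real n powr (1/24)"
    using tau_bound[of "1/24" k] by auto
  show ?case
  proof (intro exI[of _ "C + 1 + T * K"] conjI allI impI ballI)
    show "C + 1 + T * K \<ge> 0" using C K T by simp
    fix p s :: nat assume p: "prime p" and s: "s \<in> {1..p - 1}"
    let ?H = "harm_sum (p - 1)" and ?t = "\<lambda>u. real (tau k u) / real u" and ?q = "real p powr (-7/8)"
    let ?E = "\<lambda>u. L_power_coef p k u - ?t u"
    have p1: "p > 1" using p by (rule prime_gt_1_nat)
    have H: "?H \<ge> 1" using p1 by (intro harm_sum_ge_1) simp
    have "L_power_coef p (Suc k) s = mconv p (L_coef p) (\<lambda>u. ?E u + ?t u) s" by simp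
    also have "\<dots> = mconv p (L_coef p) ?E s + mconv p (\<lambda>r. (L_coef p r - 1 / real r) + 1 / real r) ?t s"
      by (subst mconv_add_right) simp
    also have "\<dots> = mconv p (L_coef p) ?E s + mconv p ?t (\<lambda>r. L_coef p r - 1 / real r) s
        + mconv p (\<lambda>r. 1 / real r) ?t s"
      by (subst mconv_add_left) (simp add: mconv_commute)
    finally have eq: "L_power_coef p (Suc k) s - real (tau (Suc k) s) / real s
      = mconv p (L_coef p) ?E s + mconv p ?t (\<lambda>r. L_coef p r - 1 / real r) s
        + (mconv p (\<lambda>r. 1 / real r) ?t s - real (tau (Suc k) s) / real s)" by simp
    have bnd: "1 / real r - 1 / real p \<le> L_coef p r" "L_coef p r \<le> 1 / real r" "0 \<le> L_coef p r"
      if "r \<in> {1..p - 1}" for r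
    proof -
      have r: "0 < r" "r \<le> p" using that p1 by auto
      show "1 / real r - 1 / real p \<le> L_coef p r" "L_coef p r \<le> 1 / real r"
        using L_coef_lower[OF r] L_coef_upper[OF r] by auto
      moreover have "1 / real p \<le> 1 / real r" using r by (intro divide_left_mono) auto
      ultimately show "0 \<le> L_coef p r" by linarith
    qed
    have "\<bar>mconv p (L_coef p) ?E s\<bar> \<le> (\<Sum>r = 1..p - 1. \<bar>L_coef p r\<bar>) * (C * ?H ^ k * ?q)"
      by (intro abs_mconv_le[OF p] C p) (use C H in auto)
    also have "\<dots> \<le> ?H * (C * ?H ^ k * ?q)"
    proof (rule mult_right_mono)
      show "(\<Sum>r = 1..p - 1. \<bar>L_coef p r\<bar>) \<le> ?H"
        unfolding harm_sum_def by (intro sum_mono) (use bnd in auto)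
    qed (use C(1) H in auto)
    finally have 1: "\<bar>mconv p (L_coef p) ?E s\<bar> \<le> C * (?H ^ Suc k * ?q)" by (simp add: mult_ac)
    have "\<bar>mconv p ?t (\<lambda>r. L_coef p r - 1 / real r) s\<bar> \<le> (\<Sum>u = 1..p - 1. \<bar>?t u\<bar>) * (1 / real p)"
    proof (intro abs_mconv_le[OF p])
      fix r assume "r \<in> {1..p - 1}"
      from bnd[OF this] show "\<bar>L_coef p r - 1 / real r\<bar> \<le> 1 / real p" by linarith
    qed simp
    also have "\<dots> \<le> ?H ^ Suc k * ?q"
    proof (rule mult_mono)
      have "(\<Sum>u = 1..p - 1. \<bar>?t u\<bar>) \<le> ?H ^ k" using sum_tau_le[where N = "p - 1" and k = k] by simp
      also have "\<dots> \<le> ?H ^ Suc k" by (rule power_increasing) (use H in auto)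
      finally show "(\<Sum>u = 1..p - 1. \<bar>?t u\<bar>) \<le> ?H ^ Suc k" .
      have "1 / real p = real p powr (-1)" using p1 by (simp add: powr_minus divide_inverse)
      also have "\<dots> \<le> ?q" using p1 by (intro powr_mono) auto
      finally show "1 / real p \<le> ?q" .
    qed (use H in auto)
    finally have 2: "\<bar>mconv p ?t (\<lambda>r. L_coef p r - 1 / real r) s\<bar> \<le> ?H ^ Suc k * ?q" .
    have "\<bar>mconv p (\<lambda>r. 1 / real r) ?t s - real (tau (Suc k) s) / real s\<bar> \<le> T * K * real p powr (3 * (1/24) - 1) * ?H"
      by (rule mconv_tau_error[OF p s _ K T]) auto
    also have "\<dots> = T * K * (?H ^ 1 * ?q)" by (simp add: mult_ac)
    also have "\<dots> \<le> T * K * (?H ^ Suc k * ?q)"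
      using T K H by (intro mult_left_mono mult_right_mono power_increasing) auto
    finally have 3: "\<bar>mconv p (\<lambda>r. 1 / real r) ?t s - real (tau (Suc k) s) / real s\<bar> \<le> T * K * (?H ^ Suc k * ?q)" .
    have "(C + 1 + T * K) * ?H ^ Suc k * ?q = C * (?H ^ Suc k * ?q) + ?H ^ Suc k * ?q + T * K * (?H ^ Suc k * ?q)"
      by (simp only: distrib_right mult.assoc mult_1_left)
    then show "\<bar>L_power_coef p (Suc k) s - real (tau (Suc k) s) / real s\<bar> \<le> (C + 1 + T * K) * ?H ^ Suc k * ?q"
      using 1 2 3 unfolding eq by linarith
  qed
qed

section \<open>The moment\<close>

lemma sum_relation_le:
  fixes f :: "'a \<Rightarrow> real"
  assumes "finite S" "\<And>s. s \<in> S \<Longrightarrow> real (card {u \<in> S. N s u}) \<le> D" "\<And>s. s \<in> S \<Longrightarrow> f s \<ge> 0"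
  shows "(\<Sum>s\<in>S. \<Sum>u\<in>S. if N s u then f s else 0) \<le> D * (\<Sum>s\<in>S. f s)"
proof -
  have "(\<Sum>s\<in>S. \<Sum>u\<in>S. if N s u then f s else 0) = (\<Sum>s\<in>S. real (card {u \<in> S. N s u}) * f s)"
    using assms(1) by (intro sum.cong refl) (simp add: sum.inter_filter[symmetric])
  also have "\<dots> \<le> (\<Sum>s\<in>S. D * f s)"
    by (intro sum_mono mult_right_mono assms)
  finally show ?thesis by (simp add: sum_distrib_left)
qed

lemma sum_relation_swap:
  fixes f :: "'a \<Rightarrow> 'a \<Rightarrow> real"
  assumes "\<And>s u. N s u \<longleftrightarrow> N u s"
  shows "(\<Sum>s\<in>S. \<Sum>u\<in>S. if N s u then f s u else 0) = (\<Sum>s\<in>S. \<Sum>u\<in>S. if N s u then f u s else 0)"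
  by (subst sum.swap) (use assms in \<open>auto intro!: sum.cong\<close>)

lemma mult_le_weighted_squares:
  fixes x y l :: real
  assumes "l > 0"
  shows "x * y \<le> (l * x\<^sup>2 + y\<^sup>2 / l) / 2"
proof -
  have "0 \<le> (l * x - y)\<^sup>2 / l" using assms by simp
  also have "\<dots> = l * x\<^sup>2 - 2 * (x * y) + y\<^sup>2 / l"
    using assms by (simp add: power2_eq_square field_simps)
  finally show ?thesis by simp
qed

text \<open>A Schur test in which \<open>x y \<le> (\<surd>Z x\<^sup>2 + y\<^sup>2 / \<surd>Z) / 2\<close> balances the truncated factor against the full one.\<close>

lemma sum_relation_truncated_le:
  fixes t :: "nat \<Rightarrow> real"
  assumes fin: "finite S" and card: "\<And>s. s \<in> S \<Longrightarrow> real (card {u \<in> S. N s u}) \<le> D"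
    and sym: "\<And>s u. N s u \<longleftrightarrow> N u s" and D: "D \<ge> 0"
    and Z: "Z > 0"
    and B: "(\<Sum>s\<in>S. real s * (t s)\<^sup>2) \<le> B" and S0: "\<And>s. s \<in> S \<Longrightarrow> s \<ge> 1"
  shows "(\<Sum>s\<in>S. \<Sum>u\<in>S. if N s u \<and> Z \<le> real s then t s * t u else 0) \<le> D * (B / sqrt Z)"
proof -
  define v where "v = (\<lambda>s. if Z \<le> real s then t s else 0)"
  let ?l = "sqrt Z"
  have l0: "?l > 0" using Z by simp
  have gen: "l * x / 2 = (l * l * x) * (1 / l / 2)" if "l > 0" for l x :: real
    using that by (simp add: field_simps)
  have "(\<Sum>s\<in>S. \<Sum>u\<in>S. if N s u \<and> Z \<le> real s then t s * t u else 0)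
      \<le> (\<Sum>s\<in>S. \<Sum>u\<in>S. (if N s u then ?l * (v s)\<^sup>2 / 2 else 0) + (if N s u then (t u)\<^sup>2 / ?l / 2 else 0))"
  proof (intro sum_mono)
    fix s u
    have "v s * t u \<le> (?l * (v s)\<^sup>2 + (t u)\<^sup>2 / ?l) / 2" by (rule mult_le_weighted_squares[OF l0])
    moreover have "0 \<le> (?l * (v s)\<^sup>2 + (t u)\<^sup>2 / ?l) / 2" using Z by simp
    ultimately show "(if N s u \<and> Z \<le> real s then t s * t u else 0)
        \<le> (if N s u then ?l * (v s)\<^sup>2 / 2 else 0) + (if N s u then (t u)\<^sup>2 / ?l / 2 else 0)"
      by (auto simp: v_def add_divide_distrib)
  qed
  also have "\<dots> = (\<Sum>s\<in>S. \<Sum>u\<in>S. if N s u then ?l * (v s)\<^sup>2 / 2 else 0)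
      + (\<Sum>s\<in>S. \<Sum>u\<in>S. if N s u then (t s)\<^sup>2 / ?l / 2 else 0)"
    unfolding sum.distrib
    by (subst (2) sum_relation_swap[OF sym]) simp
  also have "\<dots> \<le> D * (\<Sum>s\<in>S. ?l * (v s)\<^sup>2 / 2) + D * (\<Sum>s\<in>S. (t s)\<^sup>2 / ?l / 2)"
    by (intro add_mono sum_relation_le fin card) (use Z in auto)
  also have "\<dots> \<le> D * (B / ?l / 2) + D * (B / ?l / 2)"
  proof (intro add_mono mult_left_mono D)
    have "(\<Sum>s\<in>S. ?l * (v s)\<^sup>2 / 2) \<le> (\<Sum>s\<in>S. (real s * (t s)\<^sup>2) * (1 / ?l / 2))"
    proof (rule sum_mono)
      fix s assume s: "s \<in> S"
      show "?l * (v s)\<^sup>2 / 2 \<le> (real s * (t s)\<^sup>2) * (1 / ?l / 2)"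
      proof (cases "Z \<le> real s")
        case True
        \<comment> \<open>On the truncated range sqrt Z = Z / sqrt Z <= s / sqrt Z, which produces
          the weight s of hypothesis B.\<close>
        have "?l * (t s)\<^sup>2 / 2 = (Z * (t s)\<^sup>2) * (1 / ?l / 2)"
          using gen[OF l0, of "(t s)\<^sup>2"] Z by (simp only: real_sqrt_mult_self abs_of_pos)
        also have "\<dots> \<le> (real s * (t s)\<^sup>2) * (1 / ?l / 2)"
          using True Z by (intro mult_right_mono) auto
        finally show ?thesis using True by (simp add: v_def)
      qed (use Z in \<open>simp add: v_def\<close>)
    qed
    also have "\<dots> = (\<Sum>s\<in>S. real s * (t s)\<^sup>2) * (1 / ?l / 2)" by (simp only: sum_distrib_right)
    also have "\<dots> \<le> B * (1 / ?l / 2)" using Z by (intro mult_right_mono B) auto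
    finally show "(\<Sum>s\<in>S. ?l * (v s)\<^sup>2 / 2) \<le> B / ?l / 2" by simp
    have "(\<Sum>s\<in>S. (t s)\<^sup>2 / ?l / 2) \<le> (\<Sum>s\<in>S. (real s * (t s)\<^sup>2) * (1 / ?l / 2))"
    proof (rule sum_mono)
      fix s assume s: "s \<in> S"
      have "1 * (t s)\<^sup>2 \<le> real s * (t s)\<^sup>2" using S0[OF s] by (intro mult_right_mono) auto
      then have "1 * (t s)\<^sup>2 * (1 / ?l / 2) \<le> (real s * (t s)\<^sup>2) * (1 / ?l / 2)"
        by (rule mult_right_mono) (use Z in simp)
      moreover have "(t s)\<^sup>2 / ?l / 2 = 1 * (t s)\<^sup>2 * (1 / ?l / 2)" by simp
      ultimately show "(t s)\<^sup>2 / ?l / 2 \<le> (real s * (t s)\<^sup>2) * (1 / ?l / 2)" by (simp only:)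
    qed
    also have "\<dots> = (\<Sum>s\<in>S. real s * (t s)\<^sup>2) * (1 / ?l / 2)" by (simp only: sum_distrib_right)
    also have "\<dots> \<le> B * (1 / ?l / 2)" using Z by (intro mult_right_mono B) auto
    finally show "(\<Sum>s\<in>S. (t s)\<^sup>2 / ?l / 2) \<le> B / ?l / 2" by simp
  qed
  finally show ?thesis by (simp add: mult.commute)
qed

text \<open>Since d is odd, s^(2d) - u^(2d) = (s^d - u^d)(s^d - (-u)^d). The first factor is nonzero
  because s and u are distinct and positive, the second because (-u)^d < 0 < s^d;
  \<open>prime_dvd_power_diff_le\<close> applies to whichever factor p divides.\<close>

lemma solutions_separated:
  fixes p d s u :: nat
  assumes p: "prime p" and d: "odd d" and su: "0 < s" "0 < u" "s \<noteq> u"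
    and cong: "[s ^ (2 * d) = u ^ (2 * d)] (mod p)"
  shows "real p powr (1 / real (totient d)) \<le> real s + real u"
proof -
  have d0: "d > 0" using d by (auto intro: Nat.gr0I)
  then have t0: "totient d > 0" by simp
  have pw: "a ^ (2 * d) - b ^ (2 * d) = (a ^ d - b ^ d) * (a ^ d - (- b) ^ d)" for a b :: int
  proof -
    have "x ^ (2 * d) = x ^ d * x ^ d" for x :: int by (simp only: mult_2 power_add)
    then show ?thesis using d by (simp only:) (simp add: power_minus_odd algebra_simps)
  qed
  have "[int s ^ (2 * d) = int u ^ (2 * d)] (mod int p)"
    using cong by (metis cong_int_iff of_nat_power)
  then have "int p dvd int s ^ (2 * d) - int u ^ (2 * d)" by (simp add: cong_iff_dvd_diff)
  then have "int p dvd (int s ^ d - int u ^ d) * (int s ^ d - (- int u) ^ d)" by (simp only: pw)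
  moreover have "prime (int p)" using p by simp
  ultimately have "int p dvd int s ^ d - int u ^ d \<or> int p dvd int s ^ d - (- int u) ^ d"
    by (rule prime_dvd_multD[rotated])
  then have "real p \<le> (real s + real u) ^ totient d"
  proof
    assume *: "int p dvd int s ^ d - int u ^ d"
    have "int s ^ d \<noteq> int u ^ d"
    proof
      assume "int s ^ d = int u ^ d"
      then have "int s = int u" using d0 by (intro power_eq_imp_eq_base[of "int s" d]) auto
      then show False using su by simp
    qed
    from prime_dvd_power_diff_le[OF p * this _ d0] su show ?thesis by simp
  next
    assume *: "int p dvd int s ^ d - (- int u) ^ d"
    have "int s ^ d > 0" "(- int u) ^ d < 0" using su d by (auto simp: power_less_zero_eq)
    then have "int s ^ d \<noteq> (- int u) ^ d" by linarith
    from prime_dvd_power_diff_le[OF p * this _ d0] su show ?thesis by simp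
  qed
  then have "real p powr (1 / real (totient d)) \<le> ((real s + real u) ^ totient d) powr (1 / real (totient d))"
    by (intro powr_mono2) auto
  also have "\<dots> = real s + real u"
    using su t0 by (simp add: powr_realpow[symmetric] powr_powr)
  finally show ?thesis .
qed

text \<open>With tau_k(n) <= T n^(1/4) the terms are at most T^2 n^(-3/2), which is dominated by the
  telescoping differences of 2 T^2 / sqrt n.\<close>

lemma a_const_tail:
  "\<exists>C\<ge>0. \<forall>p\<ge>2. \<bar>(\<Sum>s = 1..p - 1. (real (tau k s) / real s)\<^sup>2) - a_const k\<bar> \<le> C * real p powr (-1/2)"
proof -
  obtain T where T: "T \<ge> 1" "\<And>n. n > 0 \<Longrightarrow> real (tau k n) \<le> T * real n powr (1/4)"
    using tau_bound[of "1/4" k] by auto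
  define f where "f = (\<lambda>n. (real (tau k (Suc n)))\<^sup>2 / (real (Suc n))\<^sup>2)"
  define e where "e = (\<lambda>n. 1 / sqrt (real n))"
  have f_le: "f n \<le> 2 * T\<^sup>2 * (e n - e (Suc n))" if n: "n \<ge> 1" for n
  proof -
    define a where "a = sqrt (real n)"
    define b where "b = sqrt (real (Suc n))"
    have ab: "a > 0" "b > 0" "a \<le> b" "b\<^sup>2 = real (Suc n)" "b\<^sup>2 - a\<^sup>2 = 1" using n by (auto simp: a_def b_def)
    have "(b - a) * (b + a) = 1" using ab(5) by (simp add: power2_eq_square algebra_simps)
    then have "b - a = 1 / (b + a)" using ab by (simp add: field_simps)
    then have ed: "e n - e (Suc n) = 1 / ((b + a) * (a * b))"
    proof -
      have "e n - e (Suc n) = 1 / a - 1 / b" by (simp add: e_def a_def b_def)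
      also have "\<dots> = (b - a) / (a * b)" using ab(1,2) by (simp add: field_simps)
      also have "\<dots> = 1 / ((b + a) * (a * b))" unfolding \<open>b - a = 1 / (b + a)\<close> by simp
      finally show ?thesis .
    qed
    have "(b + a) * (a * b) \<le> (2 * b) * (b * b)" using ab by (intro mult_mono) auto
    then have "1 / ((2 * b) * (b * b)) \<le> 1 / ((b + a) * (a * b))"
      using ab by (intro divide_left_mono) auto
    then have *: "1 / b ^ 3 \<le> 2 * (e n - e (Suc n))"
      using ab by (simp add: ed power3_eq_cube)
    have q: "real (Suc n) powr (1/4) = sqrt b"
      by (simp add: b_def powr_half_sqrt[symmetric] powr_powr)
    have "(real (tau k (Suc n)))\<^sup>2 \<le> (T * sqrt b)\<^sup>2"
      using T(2)[of "Suc n"] q by (intro power_mono) auto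
    also have "\<dots> = T\<^sup>2 * b" using ab by (simp add: power_mult_distrib)
    finally have "f n \<le> T\<^sup>2 * b / (b\<^sup>2)\<^sup>2"
      unfolding f_def ab(4)[symmetric] by (intro divide_right_mono) auto
    also have "\<dots> = T\<^sup>2 * (1 / b ^ 3)" using ab(2) by (simp add: field_simps eval_nat_numeral)
    also have "\<dots> \<le> T\<^sup>2 * (2 * (e n - e (Suc n)))" by (intro mult_left_mono *) simp
    finally show ?thesis by (simp only: mult_ac)
  qed
  have e0: "e \<longlonglongrightarrow> 0"
    unfolding e_def
    using tendsto_real_sqrt[OF lim_1_over_n[where 'a = real]] by (simp add: real_sqrt_divide)
  have tele: "(\<lambda>n. 2 * T\<^sup>2 * (e (n + N) - e (Suc n + N))) sums (2 * T\<^sup>2 * e N)" for N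
    using sums_mult[OF telescope_sums'[OF LIMSEQ_ignore_initial_segment[OF e0, of N]], of "2 * T\<^sup>2"] by simp
  have f0: "f n \<ge> 0" for n by (simp add: f_def)
  have summ: "summable (\<lambda>n. f (n + N))" if "N \<ge> 1" for N
    by (rule summable_comparison_test'[OF sums_summable[OF tele[of N]], where N = 0])
       (use f0 f_le[of "_ + N"] that in auto)
  then have sf: "summable f" using summ[of 1] summable_iff_shift[of f 1] by blast
  show ?thesis
  proof (intro exI[of _ "4 * T\<^sup>2"] conjI allI impI)
    fix p :: nat assume p: "p \<ge> 2"
    define N where "N = p - 1"
    have N: "N \<ge> 1" using p by (simp add: N_def)
    have "a_const k = (\<Sum>n. f (n + N)) + (\<Sum>n<N. f n)"
      unfolding a_const_def f_def[symmetric] by (rule suminf_split_initial_segment[OF sf])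
    also have "(\<Sum>n<N. f n) = (\<Sum>s = 1..p - 1. (real (tau k s) / real s)\<^sup>2)"
      by (rule sum.reindex_bij_witness[of _ "\<lambda>s. s - 1" Suc]) (auto simp: N_def f_def power_divide)
    finally have "\<bar>(\<Sum>s = 1..p - 1. (real (tau k s) / real s)\<^sup>2) - a_const k\<bar> = \<bar>\<Sum>n. f (n + N)\<bar>" by simp
    also have "\<dots> = (\<Sum>n. f (n + N))" using suminf_nonneg[OF summ[OF N]] f0 by simp
    also have "\<dots> \<le> 2 * T\<^sup>2 * e N"
      using suminf_le[OF _ summ[OF N] sums_summable[OF tele[of N]]] f_le[of "_ + N"] N
        sums_unique[OF tele[of N]] by simp
    also have "\<dots> \<le> 2 * T\<^sup>2 * (2 * real p powr (-1/2))"
    proof (rule mult_left_mono)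
      \<comment> \<open>The factor 4 absorbs the passage from p - 1 to p, valid as p >= 2.\<close>
      have "sqrt (real p) \<le> sqrt (4 * real N)" using p by (simp add: N_def)
      also have "\<dots> = 2 * sqrt (real N)" by (simp add: real_sqrt_mult)
      finally have "sqrt (real p) \<le> 2 * sqrt (real N)" .
      moreover have "real p powr (-1/2) = 1 / sqrt (real p)"
        using p by (simp add: powr_minus powr_half_sqrt inverse_eq_divide)
      moreover have "1 / sqrt (real N) \<le> 2 * (1 / sqrt (real p))"
        using calculation(1) p N by (simp add: field_simps)
      ultimately show "e N \<le> 2 * real p powr (-1/2)" by (simp only: e_def)
    qed simp
    finally show "\<bar>(\<Sum>s = 1..p - 1. (real (tau k s) / real s)\<^sup>2) - a_const k\<bar> \<le> 4 * T\<^sup>2 * real p powr (-1/2)"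
      by simp
  qed simp
qed


lemma abs_mult_diff_le:
  fixes a b x y e :: real
  assumes "\<bar>a - x\<bar> \<le> e" "\<bar>b - y\<bar> \<le> e" "x \<ge> 0" "y \<ge> 0"
  shows "\<bar>a * b - x * y\<bar> \<le> e * y + x * e + e * e"
proof -
  have "a * b - x * y = (a - x) * y + x * (b - y) + (a - x) * (b - y)" by (simp add: algebra_simps)
  moreover have "\<bar>(a - x) * y\<bar> \<le> e * y" "\<bar>x * (b - y)\<bar> \<le> x * e" "\<bar>(a - x) * (b - y)\<bar> \<le> e * e"
    using assms by (auto simp: abs_mult intro!: mult_mono mult_left_mono mult_right_mono)
  ultimately show ?thesis by linarith
qed

section \<open>The averaged kernel and the comparison of the moment with its diagonal\<close>

context odd_order_residues
begin

text \<open>Since 2/m = 1/h and there are h odd characters, this is their average, and it carries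
  the normalisation of the moment.\<close>

definition char_kernel :: "nat \<Rightarrow> nat \<Rightarrow> complex" where
  "char_kernel s u = (\<Sum>\<chi>\<in>odd_characters p m. dirichlet_ext p \<chi> s * cnj (dirichlet_ext p \<chi> u)) / of_nat h"

definition congruent_powers :: "nat \<Rightarrow> nat \<Rightarrow> bool" where
  "congruent_powers s u \<longleftrightarrow> [s ^ (2 * d) = u ^ (2 * d)] (mod p)"

lemma congruent_powers_sym: "congruent_powers s u \<longleftrightarrow> congruent_powers u s"
  by (auto simp: congruent_powers_def cong_sym_eq)

lemma card_congruent_powers_le: "real (card {u \<in> {1..p - 1}. congruent_powers s u}) \<le> 2 * real d"
proof -
  have "card {u \<in> {1..p - 1}. congruent_powers s u} \<le> card {x \<in> {..<p}. [x ^ (2 * d) = s ^ (2 * d)] (mod p)}"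
    using p_gt_2 by (intro card_mono) (auto simp: congruent_powers_def cong_sym_eq)
  also have "\<dots> \<le> 2 * d" using d_pos by (intro roots_mod_prime_bound[OF prime_p]) simp
  finally show ?thesis by (simp flip: of_nat_mult)
qed

lemma char_kernel_diag: "s \<in> {1..p - 1} \<Longrightarrow> char_kernel s s = 1"
proof -
  assume "s \<in> {1..p - 1}"
  then have "\<not> p dvd s" by (rule residue_not_dvd)
  then have "dirichlet_ext p \<chi> s * cnj (dirichlet_ext p \<chi> s) = 1" if "\<chi> \<in> odd_characters p m" for \<chi>
    using norm_dirichlet_ext[OF that, of s] by (simp add: complex_norm_square[symmetric])
  then show ?thesis using h_pos by (simp add: char_kernel_def card_odd_characters)
qed

lemma norm_char_kernel_le: "norm (char_kernel s u) \<le> 1"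
proof -
  have "norm (\<Sum>\<chi>\<in>odd_characters p m. dirichlet_ext p \<chi> s * cnj (dirichlet_ext p \<chi> u)) \<le> (\<Sum>\<chi>\<in>odd_characters p m. 1)"
    by (rule sum_norm_le) (simp add: norm_mult norm_dirichlet_ext)
  then show ?thesis using h_pos by (simp add: char_kernel_def norm_divide card_odd_characters)
qed

lemma char_kernel_nonzero:
  assumes "char_kernel s u \<noteq> 0" "s \<in> {1..p - 1}" "u \<in> {1..p - 1}"
  shows "congruent_powers s u"
  unfolding congruent_powers_def
  using sum_odd_characters_nonzero[of s u] assms residue_not_dvd by (auto simp: char_kernel_def)

text \<open>Pairing r with p - r shows that an odd character sums to zero over a period, as
  \<open>periodic_L_series\<close> requires.\<close>

lemma L_one_eq:
  assumes \<chi>: "\<chi> \<in> odd_characters p m"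
  shows "L_one p \<chi> = (\<Sum>r = 1..p - 1. of_real (L_coef p r) * dirichlet_ext p \<chi> r)"
  unfolding L_one_def
proof (rule periodic_L_series)
  show "norm (dirichlet_ext p \<chi> n) \<le> 1" for n by (simp add: norm_dirichlet_ext[OF \<chi>])
  have "(\<Sum>r = 1..p - 1. dirichlet_ext p \<chi> r) = (\<Sum>r = 1..p - 1. dirichlet_ext p \<chi> (p - r))"
    by (rule sum.reindex_bij_witness[of _ "\<lambda>r. p - r" "\<lambda>r. p - r"]) auto
  also have "\<dots> = (\<Sum>r = 1..p - 1. - dirichlet_ext p \<chi> r)"
    by (intro sum.cong refl dirichlet_ext_reflect[OF \<chi>]) auto
  finally show "(\<Sum>r = 1..p - 1. dirichlet_ext p \<chi> r) = 0"
    by (simp add: sum_negf)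
qed (use p_gt_2 dirichlet_ext_mod in \<open>simp_all add: dirichlet_ext_def[of p \<chi> 0]\<close>)

lemma L_moment_eq:
  "of_real (L_moment (2 * k) p m)
    = (\<Sum>s = 1..p - 1. \<Sum>u = 1..p - 1. of_real (L_power_coef p k s * L_power_coef p k u) * char_kernel s u)"
proof -
  let ?R = "{1..p - 1}" and ?c = "L_power_coef p k"
  have L: "complex_of_real (cmod (L_one p \<chi>) ^ (2 * k))
      = (\<Sum>s\<in>?R. \<Sum>u\<in>?R. of_real (?c s * ?c u) * (dirichlet_ext p \<chi> s * cnj (dirichlet_ext p \<chi> u)))"
    if \<chi>: "\<chi> \<in> odd_characters p m" for \<chi>
  proof -
    let ?X = "dirichlet_ext p \<chi>"
    note mc = odd_characters_mult[OF \<chi>]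
    have Lk: "L_one p \<chi> ^ k = (\<Sum>s\<in>?R. of_real (?c s) * ?X s)"
      unfolding L_one_eq[OF \<chi>]
      by (rule L_power_expansion[symmetric])
         (use prime_p dirichlet_ext_mod dirichlet_ext_mult[OF mc] dirichlet_ext_1[OF mc] in auto)
    have "complex_of_real (cmod (L_one p \<chi>) ^ (2 * k)) = L_one p \<chi> ^ k * cnj (L_one p \<chi> ^ k)"
      by (simp only: complex_norm_square[symmetric] norm_power power_mult[symmetric] mult.commute of_real_power)
    also have "\<dots> = (\<Sum>s\<in>?R. of_real (?c s) * ?X s) * (\<Sum>u\<in>?R. of_real (?c u) * cnj (?X u))"
      by (simp add: Lk)
    also have "\<dots> = (\<Sum>s\<in>?R. \<Sum>u\<in>?R. of_real (?c s * ?c u) * (?X s * cnj (?X u)))"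
      by (simp add: sum_product mult_ac)
    finally show ?thesis .
  qed
  have "of_real (L_moment (2 * k) p m)
      = (\<Sum>\<chi>\<in>odd_characters p m. complex_of_real (cmod (L_one p \<chi>) ^ (2 * k))) / of_nat h"
    by (simp add: L_moment_def)
  also have "\<dots> = (\<Sum>\<chi>\<in>odd_characters p m. \<Sum>s\<in>?R. \<Sum>u\<in>?R.
      of_real (?c s * ?c u) * (dirichlet_ext p \<chi> s * cnj (dirichlet_ext p \<chi> u))) / of_nat h"
    by (simp only: L cong: sum.cong)
  also have "\<dots> = (\<Sum>s\<in>?R. \<Sum>u\<in>?R. \<Sum>\<chi>\<in>odd_characters p m.
      of_real (?c s * ?c u) * (dirichlet_ext p \<chi> s * cnj (dirichlet_ext p \<chi> u))) / of_nat h"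
    by (subst sum.swap, subst (2) sum.swap) (rule refl)
  also have "\<dots> = (\<Sum>s\<in>?R. \<Sum>u\<in>?R. of_real (?c s * ?c u) * char_kernel s u)"
    by (simp only: char_kernel_def sum_divide_distrib sum_distrib_left times_divide_eq_right)
  finally show ?thesis .
qed

text \<open>Every off-diagonal pair has s >= Z or u >= Z, so two mirror images of one truncated sum
  cover them all, and \<open>sum_relation_truncated_le\<close> bounds each by 2d H / sqrt Z, with H
  the harmonic sum to the power k^2.\<close>

lemma off_diagonal_le:
  "(\<Sum>s = 1..p - 1. \<Sum>u = 1..p - 1. if congruent_powers s u \<and> s \<noteq> u then real (tau k s) / real s * (real (tau k u) / real u) else 0)
    \<le> 8 * (real d * real p powr (- (1 / (2 * real (totient d)))) * harm_sum (p - 1) ^ k\<^sup>2)"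
proof -
  let ?R = "{1..p - 1}" and ?t = "\<lambda>u. real (tau k u) / real u" and ?H = "harm_sum (p - 1) ^ k\<^sup>2"
  \<comment> \<open>Half of the lower bound for s + u, so that the larger of the two reaches
    it.\<close>
  define Z where "Z = real p powr (1 / real (totient d)) / 2"
  have Z: "Z > 0" using p_gt_2 by (simp add: Z_def)
  have B: "(\<Sum>s\<in>?R. real s * (?t s)\<^sup>2) \<le> ?H"
  proof -
    have "(\<Sum>s\<in>?R. real s * (?t s)\<^sup>2) = (\<Sum>s\<in>?R. real (tau k s) * real (tau k s) / real s)"
      by (intro sum.cong refl) (simp add: power2_eq_square)
    also have "\<dots> \<le> ?H" unfolding power2_eq_square[of k] by (rule sum_tau_tau_le)
    finally show ?thesis .
  qed
  have H0: "?H \<ge> 0" using B by (rule order.trans[rotated]) (intro sum_nonneg, simp)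
  have trunc: "(\<Sum>s\<in>?R. \<Sum>u\<in>?R. if congruent_powers s u \<and> Z \<le> real s then ?t s * ?t u else 0) \<le> 2 * real d * (?H / sqrt Z)"
    by (rule sum_relation_truncated_le[OF _ card_congruent_powers_le congruent_powers_sym _ Z B]) auto
  \<comment> \<open>1 / sqrt Z carries a factor sqrt 2, rounded up to 2; this makes the final
    constant 8.\<close>
  have z: "1 / sqrt Z \<le> 2 * real p powr (- (1 / (2 * real (totient d))))"
  proof -
    let ?y = "real p powr (1 / (2 * real (totient d)))"
    have y: "?y > 0" using p_gt_2 by simp
    have "Z = ?y\<^sup>2 / 2"
      using p_gt_2 by (simp add: Z_def power2_eq_square powr_add[symmetric])
    then have "sqrt Z = sqrt (?y\<^sup>2 / 2)" by (simp only:)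
    also have "\<dots> = ?y / sqrt 2" using y by (simp add: real_sqrt_divide)
    finally have "sqrt Z = ?y / sqrt 2" .
    moreover have "sqrt 2 \<le> sqrt 4" by (rule real_sqrt_le_mono) simp
    then have "sqrt 2 \<le> 2" by simp
    moreover have "real p powr (- (1 / (2 * real (totient d)))) = 1 / ?y" by (simp only: powr_minus inverse_eq_divide)
    moreover have "sqrt 2 / ?y \<le> 2 / ?y" using \<open>sqrt 2 \<le> 2\<close> y by (intro divide_right_mono) auto
    ultimately have "1 / sqrt Z = sqrt 2 / ?y" "2 * real p powr (- (1 / (2 * real (totient d)))) = 2 / ?y" by simp_all
    then show ?thesis using \<open>sqrt 2 / ?y \<le> 2 / ?y\<close> by (simp only:)
  qed
  \<comment> \<open>The second summand is a nested conditional so that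
    \<open>sum_relation_swap\<close> can exchange s and u in it.\<close>
  have "(\<Sum>s\<in>?R. \<Sum>u\<in>?R. if congruent_powers s u \<and> s \<noteq> u then ?t s * ?t u else 0)
      \<le> (\<Sum>s\<in>?R. \<Sum>u\<in>?R. (if congruent_powers s u \<and> Z \<le> real s then ?t s * ?t u else 0)
          + (if congruent_powers s u then if Z \<le> real u then ?t u * ?t s else 0 else 0))"
  proof (intro sum_mono)
    fix s u assume su: "s \<in> ?R" "u \<in> ?R"
    have "Z \<le> real s \<or> Z \<le> real u" if "congruent_powers s u" "s \<noteq> u"
    proof -
      have "real p powr (1 / real (totient d)) \<le> real s + real u"
        using that su unfolding congruent_powers_def by (intro solutions_separated[OF prime_p odd_d]) auto
      then show ?thesis by (auto simp: Z_def)
    qed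
    moreover have "?t s * ?t u \<ge> 0" by simp
    ultimately show "(if congruent_powers s u \<and> s \<noteq> u then ?t s * ?t u else 0)
        \<le> (if congruent_powers s u \<and> Z \<le> real s then ?t s * ?t u else 0)
          + (if congruent_powers s u then if Z \<le> real u then ?t u * ?t s else 0 else 0)"
      by (auto simp: mult.commute)
  qed
  also have "\<dots> = (\<Sum>s\<in>?R. \<Sum>u\<in>?R. if congruent_powers s u \<and> Z \<le> real s then ?t s * ?t u else 0)
      + (\<Sum>s\<in>?R. \<Sum>u\<in>?R. if congruent_powers s u then if Z \<le> real s then ?t s * ?t u else 0 else 0)"
    unfolding sum.distrib by (subst (2) sum_relation_swap[OF congruent_powers_sym]) simp
  also have "(\<Sum>s\<in>?R. \<Sum>u\<in>?R. if congruent_powers s u then if Z \<le> real s then ?t s * ?t u else 0 else 0)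
      = (\<Sum>s\<in>?R. \<Sum>u\<in>?R. if congruent_powers s u \<and> Z \<le> real s then ?t s * ?t u else 0)"
    by (intro sum.cong refl) simp
  also have "(\<Sum>s\<in>?R. \<Sum>u\<in>?R. if congruent_powers s u \<and> Z \<le> real s then ?t s * ?t u else 0)
      + (\<Sum>s\<in>?R. \<Sum>u\<in>?R. if congruent_powers s u \<and> Z \<le> real s then ?t s * ?t u else 0) \<le> 4 * real d * (?H / sqrt Z)"
    using trunc by simp
  also have "\<dots> \<le> 8 * (real d * real p powr (- (1 / (2 * real (totient d)))) * ?H)"
  proof -
    have "(4 * real d * ?H) * (1 / sqrt Z) \<le> (4 * real d * ?H) * (2 * real p powr (- (1 / (2 * real (totient d)))))"
      by (rule mult_left_mono[OF z]) (use H0 in simp)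
    then show ?thesis by (simp add: mult_ac)
  qed
  finally show ?thesis .
qed

text \<open>The double sum splits into the replacement of the coefficients by tau_k(s)/s, the
  off-diagonal part and the diagonal. The replacement error also lives on congruent pairs only, so
  the term \<eta>^2 is summed over at most 2 d p pairs instead of p^2.\<close>

lemma moment_diff_le:
  assumes \<eta>: "\<And>s. s \<in> {1..p - 1} \<Longrightarrow> \<bar>L_power_coef p k s - real (tau k s) / real s\<bar> \<le> \<eta>" "\<eta> \<ge> 0"
  shows "\<bar>L_moment (2 * k) p m - (\<Sum>s = 1..p - 1. (real (tau k s) / real s)\<^sup>2)\<bar>
    \<le> 2 * real d * (2 * \<eta> * harm_sum (p - 1) ^ k + real p * \<eta>\<^sup>2)
      + 8 * (real d * real p powr (- (1 / (2 * real (totient d)))) * harm_sum (p - 1) ^ k\<^sup>2)"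
proof -
  let ?R = "{1..p - 1}" and ?t = "\<lambda>u. real (tau k u) / real u" and ?c = "L_power_coef p k"
  have abs_eq: "\<bar>x\<bar> = norm z" if "complex_of_real x = z" for x z
    using that by (auto simp: norm_of_real)
  have split: "of_real (?c s * ?c u) * char_kernel s u
      = of_real (?c s * ?c u - ?t s * ?t u) * char_kernel s u
        + (if congruent_powers s u \<and> s \<noteq> u then of_real (?t s * ?t u) * char_kernel s u else 0)
        + (if s = u then of_real ((?t s)\<^sup>2) else 0)" if "s \<in> ?R" "u \<in> ?R" for s u
  proof (cases "s = u")
    case True
    then show ?thesis using char_kernel_diag[OF that(1)] by (simp add: power2_eq_square)
  next
    case False
    then show ?thesis using char_kernel_nonzero[OF _ that]
      by (cases "char_kernel s u = 0") (simp_all add: algebra_simps)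
  qed
  have "complex_of_real (L_moment (2 * k) p m)
    = (\<Sum>s\<in>?R. \<Sum>u\<in>?R. of_real (?c s * ?c u - ?t s * ?t u) * char_kernel s u)
      + (\<Sum>s\<in>?R. \<Sum>u\<in>?R. if congruent_powers s u \<and> s \<noteq> u then of_real (?t s * ?t u) * char_kernel s u else 0)
      + (\<Sum>s\<in>?R. \<Sum>u\<in>?R. if s = u then of_real ((?t s)\<^sup>2) else 0)" (is "_ = ?A + ?B + _")
    unfolding L_moment_eq sum.distrib[symmetric] by (intro sum.cong refl split)
  also have "(\<Sum>s\<in>?R. \<Sum>u\<in>?R. if s = u then of_real ((?t s)\<^sup>2) else 0) = complex_of_real (\<Sum>s\<in>?R. (?t s)\<^sup>2)"
    by simp
  finally have "complex_of_real (L_moment (2 * k) p m - (\<Sum>s\<in>?R. (?t s)\<^sup>2)) = ?A + ?B"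
    by simp
  then have "\<bar>L_moment (2 * k) p m - (\<Sum>s\<in>?R. (?t s)\<^sup>2)\<bar> = norm (?A + ?B)"
    by (rule abs_eq)
  also have "\<dots> \<le> norm ?A + norm ?B" by (rule norm_triangle_ineq)
  also have "norm ?A \<le> 2 * real d * (2 * \<eta> * harm_sum (p - 1) ^ k + real p * \<eta>\<^sup>2)"
  proof -
    have "norm ?A \<le> (\<Sum>s\<in>?R. \<Sum>u\<in>?R. (if congruent_powers s u then \<eta> * ?t s + \<eta>\<^sup>2 else 0) + (if congruent_powers s u then \<eta> * ?t u else 0))"
    proof (rule order.trans[OF norm_sum], rule sum_mono, rule order.trans[OF norm_sum], rule sum_mono)
      fix s u assume su: "s \<in> ?R" "u \<in> ?R"
      show "norm (of_real (?c s * ?c u - ?t s * ?t u) * char_kernel s u)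
        \<le> (if congruent_powers s u then \<eta> * ?t s + \<eta>\<^sup>2 else 0) + (if congruent_powers s u then \<eta> * ?t u else 0)"
      proof (cases "congruent_powers s u")
        case True
        have "\<bar>?c s * ?c u - ?t s * ?t u\<bar> \<le> \<eta> * ?t u + ?t s * \<eta> + \<eta> * \<eta>"
          by (rule abs_mult_diff_le) (use \<eta>(1)[OF su(1)] \<eta>(1)[OF su(2)] in auto)
        then have "\<bar>?c s * ?c u - ?t s * ?t u\<bar> * norm (char_kernel s u) \<le> (\<eta> * ?t u + ?t s * \<eta> + \<eta> * \<eta>) * 1"
          using norm_char_kernel_le by (intro mult_mono) auto
        then show ?thesis using True by (simp add: norm_mult power2_eq_square mult.commute del: of_real_diff of_real_mult)
      next
        case False
        then have "char_kernel s u = 0" using char_kernel_nonzero su by blast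
        then show ?thesis using False by simp
      qed
    qed
    also have "\<dots> = (\<Sum>s\<in>?R. \<Sum>u\<in>?R. if congruent_powers s u then \<eta> * ?t s + \<eta>\<^sup>2 else 0)
        + (\<Sum>s\<in>?R. \<Sum>u\<in>?R. if congruent_powers s u then \<eta> * ?t s else 0)"
      unfolding sum.distrib by (subst (2) sum_relation_swap[OF congruent_powers_sym]) simp
    also have "\<dots> \<le> 2 * real d * (\<Sum>s\<in>?R. \<eta> * ?t s + \<eta>\<^sup>2) + 2 * real d * (\<Sum>s\<in>?R. \<eta> * ?t s)"
      by (intro add_mono sum_relation_le card_congruent_powers_le) (use \<eta>(2) in auto)
    also have "\<dots> = 2 * real d * (2 * \<eta> * (\<Sum>s\<in>?R. ?t s) + real (p - 1) * \<eta>\<^sup>2)"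
      by (simp only: sum.distrib sum_distrib_left[symmetric] sum_constant) (simp add: algebra_simps)
    also have "\<dots> \<le> 2 * real d * (2 * \<eta> * harm_sum (p - 1) ^ k + real p * \<eta>\<^sup>2)"
    proof (intro mult_left_mono add_mono)
      show "(\<Sum>s\<in>?R. ?t s) \<le> harm_sum (p - 1) ^ k" by (rule sum_tau_le)
      show "real (p - 1) * \<eta>\<^sup>2 \<le> real p * \<eta>\<^sup>2" by (rule mult_right_mono) simp_all
    qed (use \<eta>(2) in simp_all)
    finally show ?thesis .
  qed
  also have "norm ?B \<le> 8 * (real d * real p powr (- (1 / (2 * real (totient d)))) * harm_sum (p - 1) ^ k\<^sup>2)"
  proof (rule order.trans[OF _ off_diagonal_le],
      rule order.trans[OF norm_sum], rule sum_mono, rule order.trans[OF norm_sum], rule sum_mono)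
    fix s u
    have "\<bar>?t s * ?t u\<bar> * norm (char_kernel s u) \<le> ?t s * ?t u * 1"
      using norm_char_kernel_le by (intro mult_mono) auto
    then show "norm (if congruent_powers s u \<and> s \<noteq> u then of_real (?t s * ?t u) * char_kernel s u else 0)
        \<le> (if congruent_powers s u \<and> s \<noteq> u then ?t s * ?t u else 0)"
      by (simp only: if_distrib[of norm] norm_mult norm_of_real norm_zero mult_1_right split: if_splits) auto
  qed
  finally show ?thesis by simp
qed

end

theorem theorem2p12:
  fixes k :: nat
  assumes "k \<ge> 1"
  shows "\<exists>C :: real. \<forall>\<^sub>F p :: nat in sequentially. \<forall>m d :: nat.
           prime p \<longrightarrow> m dvd p - 1 \<longrightarrow> d = (p - 1) div m \<longrightarrow> odd d \<longrightarrow>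
             \<bar>L_moment (2 * k) p m - a_const k\<bar>
               \<le> C * (real d * real p powr (- (1 / (2 * real (totient d))))
                        * ln (real p) ^ (10 * k\<^sup>2 + 10))"
proof -
  obtain C where C: "C \<ge> 0" "\<And>p s. prime p \<Longrightarrow> s \<in> {1..p - 1} \<Longrightarrow>
      \<bar>L_power_coef p k s - real (tau k s) / real s\<bar> \<le> C * harm_sum (p - 1) ^ k * real p powr (-7/8)"
    using L_power_coef_error[of k] by blast
  obtain A where A: "A \<ge> 0" "\<And>p. p \<ge> 2 \<Longrightarrow>
      \<bar>(\<Sum>s = 1..p - 1. (real (tau k s) / real s)\<^sup>2) - a_const k\<bar> \<le> A * real p powr (-1/2)"
    using a_const_tail[of k] by blast
  \<comment> \<open>Only the powers 2k and k^2 of the harmonic sum occur, both at most e.\<close>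
  define e where "e = 10 * k\<^sup>2 + 10"
  \<comment> \<open>2(2C + C^2) + 8 collects the replacement and off-diagonal terms, 2^e comes from
    H <= 2L, and A from the tail of a(k).\<close>
  define D where "D = (4 * C + 2 * C\<^sup>2 + 8) * 2 ^ e + A"
  have "\<bar>L_moment (2 * k) p m - a_const k\<bar>
      \<le> D * (real d * real p powr (- (1 / (2 * real (totient d)))) * ln (real p) ^ e)"
    if p3: "p \<ge> 3" and p: "prime p" and m: "m dvd p - 1" and d: "d = (p - 1) div m" and odd_d: "odd d"
    for p m d :: nat
  proof -
    have "m * d = p - 1" using m d by simp
    moreover have "even (p - 1)" using p p3 prime_odd_nat[of p] by simp
    ultimately have "even m" using odd_d by (metis even_mult_iff)
    then obtain h where h: "m = 2 * h" by (elim evenE)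
    obtain g where g: "residue_primroot p g" using prime_primitive_root_exists[of p] p p3 by auto
    interpret odd_order_residues p h d g
      using p \<open>m * d = p - 1\<close> h odd_d g by unfold_locales (simp_all add: mult.assoc)
    define H where "H = harm_sum (p - 1)"
    define P where "P = real p powr (- (1 / (2 * real (totient d))))"
    define q where "q = real p powr (-1/2)"
    define L where "L = ln (real p)"
    \<comment> \<open>The threshold p >= 3 exceeds exp 1, so the logarithm is at least 1 and 1 + L
      can be absorbed into 2L.\<close>
    have L1: "L \<ge> 1"
    proof -
      have "exp 1 \<le> real p" using exp_le p3 by linarith
      then show ?thesis using p3 by (simp add: L_def ln_ge_iff)
    qed
    have H1: "H \<ge> 1" using p3 unfolding H_def by (intro harm_sum_ge_1) simp
    have "H \<le> 1 + ln (real (p - 1))" unfolding H_def using p3 by (intro harm_sum_le) simp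
    also have "ln (real (p - 1)) \<le> L" using p3 by (simp add: L_def)
    finally have H2: "H \<le> 2 * L" using L1 by simp
    have Hpow: "H ^ j \<le> 2 ^ e * L ^ e" if "j \<le> e" for j
    proof -
      have "H ^ j \<le> H ^ e" using that H1 by (rule power_increasing)
      also have "\<dots> \<le> (2 * L) ^ e" using H2 H1 by (intro power_mono) auto
      finally show ?thesis by (simp add: power_mult_distrib)
    qed
    \<comment> \<open>All secondary errors are measured by p^(-1/2) and absorbed here because phi(d)
      >= 1.\<close>
    have qP: "q \<le> P"
    proof -
      have "totient d \<ge> 1" using d_pos by (simp add: Suc_le_eq)
      then have "1 / (2 * real (totient d)) \<le> 1 / (2 * 1)" using d_pos by (intro divide_left_mono) auto
      then show ?thesis unfolding q_def P_def using p3 by (intro powr_mono) auto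
    qed
    have q0: "q \<ge> 0" and P0: "P \<ge> 0" by (simp_all add: q_def P_def)
    define \<eta> where "\<eta> = C * H ^ k * real p powr (-7/8)"
    define W where "W = H ^ (2 * k)"
    have W: "H ^ k * H ^ k = W" by (simp only: W_def mult_2 power_add)
    have W0: "W \<ge> 0" using H1 by (simp add: W_def)
    have \<eta>1: "2 * \<eta> * H ^ k \<le> 2 * C * (W * q)"
    proof -
      have "real p powr (-7/8) \<le> q" unfolding q_def using p3 by (intro powr_mono) auto
      then have "2 * C * (W * real p powr (-7/8)) \<le> 2 * C * (W * q)"
        using C(1) W0 by (intro mult_left_mono) auto
      moreover have "2 * \<eta> * H ^ k = 2 * C * (H ^ k * H ^ k * real p powr (-7/8))"
        by (simp only: \<eta>_def mult_ac)
      ultimately show ?thesis by (simp only: W)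
    qed
    \<comment> \<open>1 - 2 * 7/8 = -3/4, which is at most -1/2.\<close>
    have \<eta>2: "real p * \<eta>\<^sup>2 \<le> C\<^sup>2 * (W * q)"
    proof -
      have "real p powr 1 = real p" by simp
      then have "real p * (real p powr (-7/8))\<^sup>2 = real p powr 1 * (real p powr (-7/8) * real p powr (-7/8))"
        by (simp only: power2_eq_square)
      also have "\<dots> = real p powr (1 + (-7/8 + -7/8))" by (simp only: powr_add)
      also have "\<dots> \<le> q" unfolding q_def using p3 by (intro powr_mono) auto
      finally have "C\<^sup>2 * (W * (real p * (real p powr (-7/8))\<^sup>2)) \<le> C\<^sup>2 * (W * q)"
        using W0 by (intro mult_left_mono) auto
      moreover have "real p * \<eta>\<^sup>2 = C\<^sup>2 * (H ^ k * H ^ k * (real p * (real p powr (-7/8))\<^sup>2))"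
        by (simp only: \<eta>_def power_mult_distrib power2_eq_square mult_ac)
      ultimately show ?thesis by (simp only: W)
    qed
    have "\<bar>L_moment (2 * k) p m - a_const k\<bar>
        \<le> \<bar>L_moment (2 * k) p (2 * h) - (\<Sum>s = 1..p - 1. (real (tau k s) / real s)\<^sup>2)\<bar>
          + \<bar>(\<Sum>s = 1..p - 1. (real (tau k s) / real s)\<^sup>2) - a_const k\<bar>"
      unfolding h by linarith
    also have "\<dots> \<le> (2 * real d * (2 * \<eta> * H ^ k + real p * \<eta>\<^sup>2) + 8 * (real d * P * H ^ k\<^sup>2)) + A * q"
    proof (rule add_mono)
      show "\<bar>L_moment (2 * k) p (2 * h) - (\<Sum>s = 1..p - 1. (real (tau k s) / real s)\<^sup>2)\<bar>
          \<le> 2 * real d * (2 * \<eta> * H ^ k + real p * \<eta>\<^sup>2) + 8 * (real d * P * H ^ k\<^sup>2)"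
        unfolding H_def P_def
      proof (rule moment_diff_le)
        show "\<bar>L_power_coef p k s - real (tau k s) / real s\<bar> \<le> \<eta>" if "s \<in> {1..p - 1}" for s
          unfolding \<eta>_def H_def by (rule C(2)[OF p that])
        show "\<eta> \<ge> 0" unfolding \<eta>_def using C(1) H1 by simp
      qed
      show "\<bar>(\<Sum>s = 1..p - 1. (real (tau k s) / real s)\<^sup>2) - a_const k\<bar> \<le> A * q"
        unfolding q_def using p3 by (intro A(2)) simp
    qed
    also have "\<dots> \<le> (2 * real d * (2 * C * (W * q) + C\<^sup>2 * (W * q)) + 8 * (real d * P * H ^ k\<^sup>2)) + A * q"
      by (intro add_right_mono mult_left_mono add_mono \<eta>1 \<eta>2) simp
    also have "\<dots> \<le> 2 * real d * (2 * C * (2 ^ e * L ^ e * P) + C\<^sup>2 * (2 ^ e * L ^ e * P))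
          + 8 * (real d * P * (2 ^ e * L ^ e)) + A * (real d * P * L ^ e)"
    proof -
      have k1: "2 * k \<le> e"
      proof -
        have "k \<le> k\<^sup>2" by (simp add: power2_eq_square)
        then show ?thesis by (simp add: e_def)
      qed
      have k2: "k\<^sup>2 \<le> e" by (simp add: e_def)
      have a: "W * q \<le> 2 ^ e * L ^ e * P"
        unfolding W_def using qP q0 L1 by (intro mult_mono Hpow k1) auto
      have "q * 1 * 1 \<le> P * real d * L ^ e"
        using qP d_pos L1 P0 by (intro mult_mono one_le_power) auto
      then have b: "q \<le> real d * P * L ^ e" by (simp add: mult_ac)
      show ?thesis
        by (intro add_mono mult_left_mono a b Hpow k2) (use C(1) A(1) P0 in auto)
    qed
    also have "\<dots> = D * (real d * P * L ^ e)"
    proof -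
      have "2 * x * (2 * c * (y * l * z) + c' * (y * l * z)) + 8 * (x * z * (y * l)) + a * (x * z * l)
          = ((4 * c + 2 * c' + 8) * y + a) * (x * z * l)" for x c c' y l z a :: real
        by (simp add: algebra_simps)
      then show ?thesis unfolding D_def .
    qed
    finally show ?thesis unfolding P_def L_def .
  qed
  then show ?thesis
    unfolding e_def
    by (intro exI[of _ D] eventually_sequentiallyI[of 3] allI impI)
qed

end
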